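(* For every integer $q$ with $2\le q\le 200$: (1) $\Lambda_q=\Gamma_q$ as subsets of $\mathbb{Z}/(q^2-1)\mathbb{Z}$; and (2) for every integer $k$ with $\gcd(k,q)=1$, there exist integers $a,b$ with $b\ge 1$ and $\gcd(a,b)=1$ such that $S(a,b)=\frac{k}{q}$ if and only if both of the following conditions hold: - if $3\nmid q$, then $3\mid k$; - if $2\nmid q$, then $k\equiv 2\pmod 4$ when $q\equiv 3\pmod 4$; $k\equiv 0\pmod 8$ when $q$ is a square; and $k\equiv 0\pmod 4$ in all remaining cases.
   Context: For coprime integers $a,b$ with $b>0$, the Dedekind sum is $s(a,b)=\sum_{k=1}^{b}\left(\!\left(\frac{k}{b}\right)\!\right)\left(\!\left(\frac{ak}{b}\right)\!\right)$, where $((x))=\{x\}-\frac12$ if $x\in\mathbb{R}\setminus\mathbb{Z}$ (with $\{x\}$ the fractional part) and $((x))=0$ if $x\in\mathbb{Z}$. The normalized Dedekind sum is $S(a,b)=12\,s(a,b)$. For an integer $q\ge 2$, define $$\Lambda_q=\left\{\frac{(q^2-1)a}{t}-qS(aq,t)\pmod{q^2-1} : a,t\in\mathbb{Z},\ t>0,\ t\mid a^2+1,\ \gcd(aq,t)=1\right\}\subseteq \mathbb{Z}/(q^2-1)\mathbb{Z}$$ (the expressions $\frac{(q^2-1)a}{t}-qS(aq,t)$ are integers for such $a,t$), and define $\Gamma_q\subseteq\mathbb{Z}/(q^2-1)\mathbb{Z}$ by $\Gamma_q=\{24s : s\in\mathbb{Z}/(q^2-1)\mathbb{Z}\}$ if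 $q$ is a perfect square, and $\Gamma_q=\{12s : s\in\mathbb{Z}/(q^2-1)\mathbb{Z}\}$ otherwise. *)

theory Defs
  imports Complex_Main "HOL-Number_Theory.Residues" "HOL-Computational_Algebra.Nth_Powers"
begin

definition sawtooth :: "real \<Rightarrow> real" where
  "sawtooth x = (if x \<in> \<int> then 0 else frac x - 1 / 2)"

definition dedekind_sum :: "int \<Rightarrow> int \<Rightarrow> real" where
  "dedekind_sum a b =
    (\<Sum>k = 1..b. sawtooth (of_int k / of_int b) * sawtooth (of_int (a * k) / of_int b))"

definition normalized_dedekind_sum :: "int \<Rightarrow> int \<Rightarrow> real" where
  "normalized_dedekind_sum a b = 12 * dedekind_sum a b"

(* Subsets of Z/(q^2-1)Z are sets of canonical representatives in {0..q^2-2},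
   the carrier of residue_ring (q^2-1). *)

(* The real expression is an integer for all admissible a, t; n is that integer. *)
definition Lambda_set :: "int \<Rightarrow> int set" where
  "Lambda_set q = {n mod (q\<^sup>2 - 1) | n a t :: int.
     t > 0 \<and> t dvd a\<^sup>2 + 1 \<and> coprime (a * q) t \<and>
     real_of_int n =
       of_int ((q\<^sup>2 - 1) * a) / of_int t - of_int q * normalized_dedekind_sum (a * q) t}"

definition Gamma_set :: "int \<Rightarrow> int set" where
  "Gamma_set q =
    (if is_square q
     then {(24 * s) mod (q\<^sup>2 - 1) | s. s \<in> carrier (residue_ring (q\<^sup>2 - 1))}
     else {(12 * s) mod (q\<^sup>2 - 1) | s. s \<in> carrier (residue_ring (q\<^sup>2 - 1))})"

end

theory Submission
  imports Defs
begin

text \<open>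
  The Rademacher function \<open>\<Phi>\<close> on the modular group, given by
  \<open>(a + d) / c - S(d, c)\<close> for \<open>c > 0\<close>, is additive up to a sign term. A value \<open>S(a, b) = k / q\<close>
  comes from a unimodular matrix \<open>M\<close> with \<open>q (a + d) = k c\<close> and \<open>\<Phi>(M) = 0\<close>; multiplying \<open>M\<close> by
  two fixed matrices on the left and on the right gives a matrix with \<open>a = - q\<^sup>2 d\<close>, and since the
  sign terms cancel, \<open>\<Phi>\<close> changes by a constant depending only on \<open>k\<close> and \<open>q\<close>. The elements of
  \<open>\<Lambda>\<^sub>q\<close> are, up to the factor \<open>- q\<close>, also the values of \<open>\<Phi>\<close> at such matrices. Hence both claims
  reduce to determining the set \<open>P\<close> of values of \<open>\<Phi>\<close> at the unimodular matrices with \<open>a = - q\<^sup>2 d\<close>.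

  Elementary congruences for Dedekind sums modulo 3, 4 and 8 bound \<open>P\<close> from above. From below,
  twisted conjugation \<open>M \<mapsto> h M (X h X\<^sup>-\<^sup>1)\<^sup>-\<^sup>1\<close> with \<open>X = diag(1, q\<^sup>2)\<close> shifts \<open>\<Phi>(M)\<close> by
  \<open>\<Phi>(h) - \<Phi>(X h X\<^sup>-\<^sup>1)\<close>, independently of \<open>M\<close>, so \<open>P\<close> is invariant under a group of translations.
  For each \<open>q \<le> 200\<close> one explicit \<open>h\<close> shows that this group contains 24; if \<open>q\<close> is odd and not a
  square, one explicit element of \<open>P\<close> that is 4 modulo 8 supplies the remaining coset.
\<close>

section \<open>Dedekind sums and reciprocity\<close>

abbreviation dsum :: "int \<Rightarrow> int \<Rightarrow> real" where
  "dsum \<equiv> normalized_dedekind_sum"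

text \<open>For coprime arguments with \<open>b > 0\<close> this is \<open>b\<close> times
  \<open>dsum a b\<close>. The form with floors is integral by construction and can be
  evaluated.\<close>

definition dnum :: "int \<Rightarrow> int \<Rightarrow> int" where
  "dnum a b = 2 * a * (b - 1) * (2 * b - 1) - 12 * (\<Sum>k = 1..<b. k * (a * k div b)) - 3 * b * (b - 1)"

lemma mult_mod_bij_betw:
  fixes a b :: int
  assumes "coprime a b" "b > 0"
  shows "bij_betw (\<lambda>k. a * k mod b) {1..<b} {1..<b}"
proof -
  have inj: "inj_on (\<lambda>k. a * k mod b) {1..<b}"
  proof (rule inj_onI)
    fix x y assume xy: "x \<in> {1..<b}" "y \<in> {1..<b}" "a * x mod b = a * y mod b"
    then have "[x = y] (mod b)"
      using assms(1) by (simp add: cong_def cong_mult_lcancel flip: cong_def)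
    with xy show "x = y" by (simp add: cong_def)
  qed
  have "a * k mod b \<in> {1..<b}" if "k \<in> {1..<b}" for k
  proof -
    have "\<not> b dvd a * k"
      using that assms by (auto simp: coprime_dvd_mult_right_iff coprime_commute dest: zdvd_imp_le)
    then have "a * k mod b \<noteq> 0" by auto
    moreover have "0 \<le> a * k mod b" "a * k mod b < b" using assms(2) by auto
    ultimately show ?thesis by simp
  qed
  then have "(\<lambda>k. a * k mod b) ` {1..<b} \<subseteq> {1..<b}" by blast
  then show ?thesis
    using inj by (simp add: bij_betw_def endo_inj_surj)
qed

lemma sum_mult_mod:
  fixes a b :: int and f :: "int \<Rightarrow> 'a :: comm_monoid_add"
  assumes "coprime a b" "b > 0"
  shows "(\<Sum>k = 1..<b. f (a * k mod b)) = (\<Sum>k = 1..<b. f k)"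
  using sum.reindex_bij_betw[OF mult_mod_bij_betw[OF assms]] .

lemma sum_Ico_int:
  fixes b :: int
  assumes "b > 0"
  shows "2 * (\<Sum>k = 1..<b. k) = b * (b - 1)"
    and "6 * (\<Sum>k = 1..<b. k\<^sup>2) = b * (b - 1) * (2 * b - 1)"
    and "(\<Sum>k = 1..<b. 1 :: int) = b - 1"
proof -
  show "(\<Sum>k = 1..<b. 1 :: int) = b - 1" using assms by simp
  have "2 * (\<Sum>k = 1..<b. k) = b * (b - 1) \<and> 6 * (\<Sum>k = 1..<b. k\<^sup>2) = b * (b - 1) * (2 * b - 1)"
    using assms
  proof (induction b rule: int_gr_induct)
    case base
    then show ?case by simp
  next
    case (step i)
    then have "{1..<i + 1} = insert i {1..<i}" by auto
    then show ?case using step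
      by (auto simp: algebra_simps power2_eq_square)
  qed
  then show "2 * (\<Sum>k = 1..<b. k) = b * (b - 1)"
    and "6 * (\<Sum>k = 1..<b. k\<^sup>2) = b * (b - 1) * (2 * b - 1)" by auto
qed

lemma sawtooth_divide:
  assumes "b > 0" "\<not> b dvd m"
  shows "sawtooth (of_int m / of_int b) = of_int (2 * (m mod b) - b) / (2 * of_int b)"
proof -
  have "real_of_int m / of_int b \<notin> \<int>"
  proof
    assume "real_of_int m / of_int b \<in> \<int>"
    then obtain n where "real_of_int m / of_int b = of_int n" by (auto elim: Ints_cases)
    then have "real_of_int m = of_int (n * b)" using assms by (simp add: field_simps)
    then have "m = n * b" by linarith
    with assms show False by simp
  qed
  moreover have "frac (real_of_int m / of_int b) = of_int (m mod b) / of_int b"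
  proof -
    have "real_of_int m = of_int (m div b * b + m mod b)" by simp
    also have "\<dots> = of_int (m div b) * of_int b + of_int (m mod b)"
      by (simp only: of_int_add of_int_mult)
    finally have "real_of_int m / of_int b = of_int (m div b) + of_int (m mod b) / of_int b"
      using assms by (simp add: field_simps)
    moreover have "0 \<le> real_of_int (m mod b) / of_int b" "real_of_int (m mod b) / of_int b < 1"
      using assms by auto
    ultimately show ?thesis by (subst frac_unique_iff) auto
  qed
  ultimately show ?thesis using assms by (simp add: sawtooth_def field_simps)
qed

text \<open>The term \<open>k = b\<close> vanishes and every other sawtooth value is a centered
  residue over \<open>2 * b\<close>, so \<open>dsum\<close> is governed by an integer sum.\<close>

lemma dsum_centered:
  assumes "coprime a b" "b > 0"
  shows "of_int (b\<^sup>2) * dsum a b = of_int (3 * (\<Sum>k = 1..<b. (2 * k - b) * (2 * (a * k mod b) - b)))"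
proof -
  have nd: "\<not> b dvd k" "\<not> b dvd a * k" if "k \<in> {1..<b}" for k
    using that assms by (auto simp: coprime_dvd_mult_right_iff coprime_commute dest: zdvd_imp_le)
  have split: "{1..b} = insert b {1..<b}" using assms by auto
  have "sawtooth 1 = 0" by (simp add: sawtooth_def)
  then have "dedekind_sum a b =
      (\<Sum>k = 1..<b. sawtooth (of_int k / of_int b) * sawtooth (of_int (a * k) / of_int b))"
    using assms unfolding dedekind_sum_def split by simp
  also have "\<dots> = (\<Sum>k = 1..<b. of_int ((2 * k - b) * (2 * (a * k mod b) - b)) / (4 * of_int b ^ 2))"
  proof (rule sum.cong)
    fix k assume k: "k \<in> {1..<b}"
    then show "sawtooth (of_int k / of_int b) * sawtooth (of_int (a * k) / of_int b)
      = of_int ((2 * k - b) * (2 * (a * k mod b) - b)) / (4 * of_int b ^ 2)"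
      using sawtooth_divide[OF assms(2) nd(1)[OF k]] sawtooth_divide[OF assms(2) nd(2)[OF k]] k
      by (simp add: power2_eq_square)
  qed simp
  finally show ?thesis
    using assms by (simp add: normalized_dedekind_sum_def flip: sum_divide_distrib)
qed

lemma dsum_cong:
  assumes "coprime a b" "b > 0" "[a = a'] (mod b)"
  shows "dsum a b = dsum a' b"
proof -
  have "coprime a' b" using assms cong_imp_coprime by blast
  moreover have "a * k mod b = a' * k mod b" for k
    using assms(3) by (metis cong_def mod_mult_left_eq)
  ultimately have "of_int (b\<^sup>2) * dsum a b = of_int (b\<^sup>2) * dsum a' b"
    using assms by (simp add: dsum_centered del: of_int_power)
  then show ?thesis using assms by simp
qed

text \<open>Substituting \<open>a' * k mod b\<close> for \<open>k\<close> exchanges the two factors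
  of each summand.\<close>

lemma dsum_inverse:
  assumes "b > 0" "[a * a' = 1] (mod b)"
  shows "dsum a b = dsum a' b"
proof -
  have co: "coprime a b" "coprime a' b"
    using assms(2) by (metis coprime_iff_invertible_int mult.commute)+
  have "(\<Sum>k = 1..<b. (2 * k - b) * (2 * (a * k mod b) - b))
      = (\<Sum>k = 1..<b. (2 * (a' * k mod b) - b) * (2 * (a * (a' * k mod b) mod b) - b))"
    using sum_mult_mod[OF co(2) assms(1), of "\<lambda>k. (2 * k - b) * (2 * (a * k mod b) - b)"] by simp
  also have "\<dots> = (\<Sum>k = 1..<b. (2 * k - b) * (2 * (a' * k mod b) - b))"
  proof (rule sum.cong)
    fix k assume k: "k \<in> {1..<b}"
    have "a * (a' * k mod b) mod b = a * a' * k mod b"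
      by (simp add: mod_mult_right_eq mult.assoc)
    also have "\<dots> = k mod b"
      using assms(2) by (metis cong_def mod_mult_left_eq mult_1)
    finally have "a * (a' * k mod b) mod b = k" using k by simp
    then show "(2 * (a' * k mod b) - b) * (2 * (a * (a' * k mod b) mod b) - b)
      = (2 * k - b) * (2 * (a' * k mod b) - b)" by simp
  qed simp
  finally have "of_int (b\<^sup>2) * dsum a b = of_int (b\<^sup>2) * dsum a' b"
    using assms co by (simp add: dsum_centered del: of_int_power)
  then show ?thesis using assms by simp
qed

lemma dsum_uminus:
  assumes "coprime a b" "b > 0"
  shows "dsum (- a) b = - dsum a b"
proof -
  have "(\<Sum>k = 1..<b. (2 * k - b) * (2 * (- a * k mod b) - b))
      = (\<Sum>k = 1..<b. - ((2 * k - b) * (2 * (a * k mod b) - b)))"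
  proof (rule sum.cong)
    fix k assume k: "k \<in> {1..<b}"
    then have "a * k mod b \<in> {1..<b}"
      using bij_betwE[OF mult_mod_bij_betw[OF assms]] by blast
    then have "- (a * k) mod b = b - a * k mod b"
      by (auto simp: zmod_zminus1_eq_if)
    then have "2 * (- a * k mod b) - b = - (2 * (a * k mod b) - b)" by simp
    then show "(2 * k - b) * (2 * (- a * k mod b) - b) = - ((2 * k - b) * (2 * (a * k mod b) - b))"
      by (simp only: mult_minus_right)
  qed simp
  then have "of_int (b\<^sup>2) * dsum (- a) b = of_int (b\<^sup>2) * - dsum a b"
    using assms dsum_centered[of "- a" b] dsum_centered[of a b]
    by (simp add: sum_negf del: of_int_power)
  then show ?thesis using assms by (metis mult_cancel_left of_int_eq_0_iff order_less_irrefl zero_eq_power2)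
qed

lemma dsum_1_right [simp]: "dsum a 1 = 0"
  using dsum_centered[of a 1] by simp

lemma dsum_eq_dnum:
  assumes "coprime a b" "b > 0"
  shows "of_int b * dsum a b = of_int (dnum a b)"
proof -
  define F where "F = (\<Sum>k = 1..<b. k * (a * k div b))"
  have md: "a * k mod b = a * k - b * (a * k div b)" for k
    by (simp add: minus_mult_div_eq_mod)
  have K: "2 * (\<Sum>k = 1..<b. a * k mod b) = b * (b - 1)"
    using sum_mult_mod[OF assms, of "\<lambda>k. k"] sum_Ico_int(1)[OF assms(2)] by simp
  have "(\<Sum>k = 1..<b. (2 * k - b) * (2 * (a * k mod b) - b))
      = (\<Sum>k = 1..<b. 4 * (k * (a * k mod b)) - 2 * b * k - 2 * b * (a * k mod b) + b\<^sup>2)"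
    by (intro sum.cong refl) (simp add: algebra_simps power2_eq_square)
  also have "\<dots> = 4 * (\<Sum>k = 1..<b. k * (a * k mod b)) - b * (2 * (\<Sum>k = 1..<b. k))
      - b * (2 * (\<Sum>k = 1..<b. a * k mod b)) + b\<^sup>2 * (b - 1)"
    using assms by (simp add: sum.distrib sum_subtractf sum_distrib_left algebra_simps)
  also have "\<dots> = 4 * (\<Sum>k = 1..<b. k * (a * k mod b)) - b\<^sup>2 * (b - 1)"
    unfolding K sum_Ico_int(1)[OF assms(2)] by (simp add: algebra_simps power2_eq_square)
  also have "(\<Sum>k = 1..<b. k * (a * k mod b)) = a * (\<Sum>k = 1..<b. k\<^sup>2) - b * F"
    unfolding md F_def by (simp add: sum_subtractf sum_distrib_left algebra_simps power2_eq_square)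
  finally have "3 * (\<Sum>k = 1..<b. (2 * k - b) * (2 * (a * k mod b) - b))
      = 2 * a * (6 * (\<Sum>k = 1..<b. k\<^sup>2)) - 12 * b * F - 3 * b\<^sup>2 * (b - 1)"
    by (simp add: algebra_simps)
  also have "\<dots> = b * dnum a b"
    unfolding sum_Ico_int(2)[OF assms(2)] dnum_def F_def
    by (simp add: algebra_simps power2_eq_square)
  finally have "of_int (b\<^sup>2) * dsum a b = of_int (b * dnum a b)"
    using dsum_centered[OF assms] by (simp only:)
  then show ?thesis using assms by (simp add: power2_eq_square)
qed

lemma dnum_centered:
  assumes "coprime a b" "b > 0"
  shows "b * dnum a b = 3 * (\<Sum>k = 1..<b. (2 * k - b) * (2 * (a * k mod b) - b))"
proof -
  have "real_of_int (b * dnum a b) = of_int (b\<^sup>2) * dsum a b"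
    using dsum_eq_dnum[OF assms] by (simp add: power2_eq_square)
  then show ?thesis using dsum_centered[OF assms] by linarith
qed

section \<open>Reciprocity by counting lattice points\<close>

lemma sum_odd_Icc: "n \<ge> 0 \<Longrightarrow> (\<Sum>j = 1..n. 2 * j - 1) = (n :: int)\<^sup>2"
proof (induction n rule: int_ge_induct)
  case (step i)
  then have "{1..i + 1} = insert (i + 1) {1..i}" by auto
  then show ?case using step by (simp add: power2_eq_square algebra_simps)
qed simp

text \<open>Multiplication by \<open>a\<close> permutes the nonzero residues and keeps their sum;
  writing residues with floors isolates the floor sum.\<close>

lemma sum_div_coprime:
  fixes a b :: int
  assumes "coprime a b" "b > 0"
  shows "2 * (\<Sum>k = 1..<b. a * k div b) = (a - 1) * (b - 1)"
proof -
  have "(\<Sum>k = 1..<b. k) = (\<Sum>k = 1..<b. a * k - b * (a * k div b))"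
    using sum_mult_mod[OF assms, of "\<lambda>k. k"] by (simp add: minus_mult_div_eq_mod)
  also have "\<dots> = a * (\<Sum>k = 1..<b. k) - b * (\<Sum>k = 1..<b. a * k div b)"
    by (simp only: sum_subtractf sum_distrib_left)
  finally have "2 * (\<Sum>k = 1..<b. k) = a * (2 * (\<Sum>k = 1..<b. k)) - b * (2 * (\<Sum>k = 1..<b. a * k div b))"
    by (simp only: algebra_simps)
  then have "b * (2 * (\<Sum>k = 1..<b. a * k div b)) = b * ((a - 1) * (b - 1))"
    unfolding sum_Ico_int(1)[OF assms(2)] by (simp add: algebra_simps)
  then show ?thesis using assms by simp
qed

text \<open>Each square is a sum of odd numbers; exchanging the summations counts the lattice points
  of the triangle below the line of slope \<open>a / b\<close> by columns instead of rows.\<close>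

lemma le_div_iff_mult_le_int:
  fixes j m b :: int
  assumes "b > 0"
  shows "j \<le> m div b \<longleftrightarrow> j * b \<le> m"
proof
  assume "j \<le> m div b"
  then have "j * b \<le> m div b * b" using assms by simp
  also have "\<dots> \<le> m" using assms pos_mod_sign[of b m] div_mult_mod_eq[of m b] by linarith
  finally show "j * b \<le> m" .
next
  assume "j * b \<le> m"
  then have "j * b div b \<le> m div b" using assms by (rule zdiv_mono1)
  then show "j \<le> m div b" using assms by simp
qed

lemma sum_div_squared:
  fixes a b :: int
  assumes "coprime a b" "b > 0" "a > 0"
  shows "(\<Sum>k = 1..<b. (a * k div b)\<^sup>2)
    = (\<Sum>j = 1..<a. (2 * j - 1) * (b - 1 - b * j div a))"
proof -
  have rng: "a * k div b < a" "0 \<le> a * k div b" if "k \<in> {1..<b}" for k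
  proof -
    have "a * k < a * b" using that assms by simp
    then show "a * k div b < a" using le_div_iff_mult_le_int[OF assms(2), of a "a * k"] by linarith
    show "0 \<le> a * k div b" using that assms by (simp add: pos_imp_zdiv_nonneg_iff)
  qed
  have set1: "{j \<in> {1..<a}. j * b \<le> a * k} = {1..a * k div b}" if "k \<in> {1..<b}" for k
    using rng[OF that] by (auto simp flip: le_div_iff_mult_le_int[OF assms(2)])
  have set2: "{k \<in> {1..<b}. j * b \<le> a * k} = {b * j div a<..<b}" if j: "j \<in> {1..<a}" for j
  proof -
    \<comment> \<open>No lattice point with \<open>0 < j < a\<close> lies on the line itself, so
      weak and strict inequalities agree.\<close>
    have nd: "\<not> a dvd b * j"
      using j assms by (auto simp: coprime_dvd_mult_right_iff dest: zdvd_imp_le)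
    have "j * b \<noteq> a * k" for k using nd by (metis dvd_triv_left mult.commute)
    moreover have "b * j div a < k \<longleftrightarrow> b * j < k * a" for k
      using le_div_iff_mult_le_int[OF assms(3), of k "b * j"] by linarith
    ultimately have iff: "j * b \<le> a * k \<longleftrightarrow> b * j div a < k" for k
      by (metis linorder_not_le mult.commute order_less_le)
    have "0 \<le> b * j div a" using j assms by (simp add: pos_imp_zdiv_nonneg_iff)
    then show ?thesis by (auto simp: iff)
  qed
  have card2: "int (card {k \<in> {1..<b}. j * b \<le> a * k}) = b - 1 - b * j div a"
    if j: "j \<in> {1..<a}" for j
  proof -
    have "b * j < b * a" using j assms by simp
    then have "b * j div a < b"
      using le_div_iff_mult_le_int[OF assms(3), of b "b * j"] by linarith
    then show ?thesis unfolding set2[OF j] by simp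
  qed
  have "(\<Sum>k = 1..<b. (a * k div b)\<^sup>2) = (\<Sum>k = 1..<b. \<Sum>j\<in>{j \<in> {1..<a}. j * b \<le> a * k}. 2 * j - 1)"
    by (intro sum.cong refl) (simp only: set1 sum_odd_Icc rng)
  also have "\<dots> = (\<Sum>j = 1..<a. \<Sum>k\<in>{k \<in> {1..<b}. j * b \<le> a * k}. 2 * j - 1)"
    by (rule sum.swap_restrict) auto
  also have "\<dots> = (\<Sum>j = 1..<a. (2 * j - 1) * (b - 1 - b * j div a))"
    by (intro sum.cong refl, subst mult.commute) (simp only: sum_constant card2)
  finally show ?thesis .
qed

text \<open>The sum \<open>H\<close> of squared floors is evaluated twice: permuting residues
  relates it to the floor sum \<open>F\<close> of \<open>dnum a b\<close>, the lattice point count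
  to the floor sum \<open>G\<close> of \<open>dnum b a\<close>. Eliminating \<open>H\<close> gives
  the law.\<close>

theorem dnum_reciprocity:
  assumes "coprime a b" "a > 0" "b > 0"
  shows "a * dnum a b + b * dnum b a = a\<^sup>2 + b\<^sup>2 + 1 - 3 * a * b"
proof -
  define F where "F = (\<Sum>k = 1..<b. k * (a * k div b))"
  define G where "G = (\<Sum>j = 1..<a. j * (b * j div a))"
  define Q where "Q = (\<Sum>k = 1..<b. k\<^sup>2)"
  define H where "H = (\<Sum>k = 1..<b. (a * k div b)\<^sup>2)"
  have co: "coprime b a" using assms(1) by (simp add: coprime_commute)
  have "Q = (\<Sum>k = 1..<b. (a * k mod b)\<^sup>2)"
    unfolding Q_def using sum_mult_mod[OF assms(1,3), of "\<lambda>k. k\<^sup>2"] by simp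
  also have "\<dots> = (\<Sum>k = 1..<b. a\<^sup>2 * k\<^sup>2 - 2 * a * b * (k * (a * k div b)) + b\<^sup>2 * (a * k div b)\<^sup>2)"
    by (intro sum.cong refl) (simp add: power2_eq_square algebra_simps flip: minus_mult_div_eq_mod)
  also have "\<dots> = a\<^sup>2 * Q - 2 * a * b * F + b\<^sup>2 * H"
    unfolding Q_def F_def H_def by (simp add: sum.distrib sum_subtractf sum_distrib_left)
  finally have 1: "Q = a\<^sup>2 * Q - 2 * a * b * F + b\<^sup>2 * H" .
  have "H = (\<Sum>j = 1..<a. (b - 1) * (2 * j) - (b - 1) * 1 - 2 * (j * (b * j div a)) + b * j div a)"
    unfolding H_def sum_div_squared[OF assms(1,3,2)]
    by (intro sum.cong refl) (simp add: algebra_simps)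
  also have "\<dots> = (b - 1) * (2 * (\<Sum>j = 1..<a. j)) - (b - 1) * (\<Sum>j = 1..<a. 1) - 2 * G
      + (\<Sum>j = 1..<a. b * j div a)"
    by (simp only: G_def sum.distrib sum_subtractf sum_distrib_left)
  finally have 2: "2 * H = 2 * (b - 1) * (a - 1)\<^sup>2 - 4 * G + (a - 1) * (b - 1)"
    unfolding sum_Ico_int(3)[OF assms(2)]
    using sum_div_coprime[OF co assms(2)] sum_Ico_int(1)[OF assms(2)]
    by (simp add: algebra_simps power2_eq_square)
  have 3: "6 * Q = b * (b - 1) * (2 * b - 1)"
    unfolding Q_def by (rule sum_Ico_int(2)[OF assms(3)])
  have "12 * a * b * F = (a\<^sup>2 - 1) * (6 * Q) + 3 * b\<^sup>2 * (2 * H)"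
    using 1 by (simp add: algebra_simps)
  then have "b * (a * F * 12 + b * G * 12) = b * ((a - 1) * (b - 1) * (8 * a * b - a - b - 1))"
    unfolding 2 3 by (simp add: algebra_simps power2_eq_square)
  then have "a * F * 12 + b * G * 12 = (a - 1) * (b - 1) * (8 * a * b - a - b - 1)"
    using assms(3) by (auto simp only: mult_cancel_left)
  moreover have "a * dnum a b + b * dnum b a
      = 2 * a\<^sup>2 * (b - 1) * (2 * b - 1) + 2 * b\<^sup>2 * (a - 1) * (2 * a - 1)
        - 3 * a * b * (a + b - 2) - (a * F * 12 + b * G * 12)"
    unfolding dnum_def F_def[symmetric] G_def[symmetric]
    by (simp add: algebra_simps power2_eq_square)
  ultimately show ?thesis
    by (simp add: algebra_simps power2_eq_square)
qed

lemma dsum_reciprocity: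
  assumes "coprime a b" "a > 0" "b > 0"
  shows "dsum a b + dsum b a = (of_int a ^ 2 + of_int b ^ 2 + 1) / (of_int a * of_int b) - 3"
proof -
  have co: "coprime b a" using assms(1) by (simp add: coprime_commute)
  have "real_of_int (a * dnum a b + b * dnum b a) = of_int (a\<^sup>2 + b\<^sup>2 + 1 - 3 * a * b)"
    using dnum_reciprocity[OF assms] by simp
  then have "of_int a * (of_int b * dsum a b) + of_int b * (of_int a * dsum b a)
      = of_int a ^ 2 + of_int b ^ 2 + 1 - 3 * of_int a * of_int b"
    by (simp add: dsum_eq_dnum[OF assms(1,3)] dsum_eq_dnum[OF co assms(2)])
  then show ?thesis using assms by (simp add: field_simps)
qed

section \<open>Congruences for the numerators\<close>

lemma three_dvd_dnum:
  assumes "coprime a b" "b > 0" "\<not> 3 dvd b"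
  shows "3 dvd dnum a b"
proof -
  have "3 dvd b * dnum a b" using dnum_centered[OF assms(1,2)] by simp
  moreover have "prime (3 :: int)" by simp
  ultimately show ?thesis using assms(3) prime_dvd_multD by blast
qed

lemma dnum_cong:
  assumes "coprime a b" "b > 0" "[a = a'] (mod b)"
  shows "dnum a b = dnum a' b"
proof -
  have "coprime a' b" using assms cong_imp_coprime by blast
  then have "real_of_int (dnum a b) = of_int (dnum a' b)"
    using dsum_cong[OF assms] dsum_eq_dnum assms by metis
  then show ?thesis by simp
qed

text \<open>For positive \<open>a\<close> this is reciprocity read modulo \<open>b\<close>;
  periodicity in \<open>a\<close> covers the rest.\<close>

lemma dnum_mult_cong:
  assumes "coprime a b" "b > 0"
  shows "[a * dnum a b = a\<^sup>2 + 1] (mod b)"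
proof -
  obtain m where m: "a + b * m > 0" "[a = a + b * m] (mod b)"
  proof
    have "\<bar>a\<bar> \<le> b * \<bar>a\<bar>" using assms(2) by (simp add: mult_le_cancel_right1)
    then show "a + b * (\<bar>a\<bar> + 1) > 0" using assms(2) by (simp add: algebra_simps)
  qed (simp add: cong_def)
  define a' where "a' = a + b * m"
  have co: "coprime a' b" using assms(1) m(2) cong_imp_coprime a'_def by blast
  have "a' * dnum a' b = a'\<^sup>2 + 1 + b * (b - 3 * a' - dnum b a')"
    using dnum_reciprocity[OF co _ assms(2)] m by (simp add: a'_def[symmetric] algebra_simps power2_eq_square)
  then have "[a' * dnum a' b = a'\<^sup>2 + 1] (mod b)" by (simp add: cong_def)
  moreover have "dnum a' b = dnum a b" using dnum_cong[OF co assms(2)] m(2) a'_def cong_sym by blast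
  moreover have aa': "[a = a'] (mod b)" using m(2) a'_def by blast
  have "[a * dnum a b = a' * dnum a b] (mod b)" using aa' by (rule cong_scalar_right)
  moreover have "[a'\<^sup>2 + 1 = a\<^sup>2 + 1] (mod b)"
    using aa' cong_sym by (intro cong_add cong_pow cong_refl) blast
  ultimately show ?thesis by (metis cong_trans)
qed

text \<open>For odd \<open>b\<close> the number \<open>dnum a b\<close> modulo 8 is governed by the number of \<open>k\<close>
  for which \<open>k\<close> and \<open>a * k mod b\<close> have different parity.\<close>

definition parity_changes :: "int \<Rightarrow> int \<Rightarrow> int set" where
  "parity_changes a b = {k \<in> {1..<b}. even (a * k mod b) \<noteq> even k}"

text \<open>As \<open>b\<close> is odd, the reflection \<open>k \<mapsto> b - k\<close> has no fixed
  point and pairs off the elements.\<close>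

lemma even_card_reflection:
  fixes b :: int
  assumes "odd b" "X \<subseteq> {1..<b}" "\<And>k. k \<in> X \<Longrightarrow> b - k \<in> X"
  shows "even (card X)"
proof -
  define Y where "Y = {k \<in> X. 2 * k < b}"
  have fin: "finite X" using assms(2) finite_subset by blast
  have "X = Y \<union> (\<lambda>k. b - k) ` Y"
  proof
    show "X \<subseteq> Y \<union> (\<lambda>k. b - k) ` Y"
    proof
      fix k assume k: "k \<in> X"
      show "k \<in> Y \<union> (\<lambda>k. b - k) ` Y"
      proof (cases "2 * k < b")
        case False
        then have "2 * k \<noteq> b" using assms(1) by auto
        then have "b - k \<in> Y" using False k assms(3) by (auto simp: Y_def)
        then show ?thesis by (metis UnI2 diff_diff_eq2 add_diff_cancel_left' image_eqI)
      qed (use k Y_def in auto)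
    qed
  qed (use assms(3) Y_def in auto)
  moreover have "Y \<inter> (\<lambda>k. b - k) ` Y = {}" unfolding Y_def by auto
  moreover have "finite Y" using fin Y_def by simp
  moreover have "card ((\<lambda>k. b - k) ` Y) = card Y" by (intro card_image inj_onI) auto
  ultimately have "card X = 2 * card Y" by (metis card_Un_disjoint finite_imageI mult_2)
  then show ?thesis by simp
qed

lemma even_reflection:
  fixes a b k :: int
  assumes "odd b" "b > 0" "coprime a b" "k \<in> {1..<b}"
  shows "even (a * (b - k) mod b) \<longleftrightarrow> odd (a * k mod b)"
proof -
  have "a * k mod b \<in> {1..<b}"
    using bij_betwE[OF mult_mod_bij_betw[OF assms(3,2)]] assms(4) by blast
  then have "- (a * k) mod b = b - a * k mod b" by (auto simp: zmod_zminus1_eq_if)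
  moreover have "a * (b - k) mod b = - (a * k) mod b"
    by (metis add_uminus_conv_diff distrib_left mod_mult_self4 mult.commute mult_minus_right)
  ultimately show ?thesis using assms(1) by simp
qed

lemma even_card_parity_changes:
  assumes "odd b" "b > 0" "coprime a b"
  shows "even (card (parity_changes a b))"
  by (rule even_card_reflection[OF assms(1)])
    (use even_reflection[OF assms] assms(1) in \<open>auto simp: parity_changes_def\<close>)

text \<open>Multiplication by \<open>a * a'\<close> changes parity iff exactly one of the successive
  multiplications by \<open>a'\<close> and \<open>a\<close> does. The set is thus a symmetric
  difference; the intersection, counted twice, contributes a multiple of 4 by reflection.\<close>

lemma card_parity_changes_mult:
  assumes "odd b" "b > 0" "coprime a b" "coprime a' b"
  shows "[card (parity_changes (a * a') b) = card (parity_changes a b) + card (parity_changes a' b)] (mod 4)"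
proof -
  define X where "X = {k \<in> {1..<b}. even (a * (a' * k mod b) mod b) \<noteq> even (a' * k mod b)}"
  define Y where "Y = parity_changes a' b"
  have bij: "bij_betw (\<lambda>k. a' * k mod b) {1..<b} {1..<b}"
    by (rule mult_mod_bij_betw) fact+
  have "X \<subseteq> {1..<b}" "Y \<subseteq> {1..<b}" by (auto simp: X_def Y_def parity_changes_def)
  then have fin: "finite X" "finite Y" using finite_subset by blast+
  have "bij_betw (\<lambda>k. a' * k mod b) X (parity_changes a b)"
  proof (rule bij_betw_subset[OF bij])
    show "(\<lambda>k. a' * k mod b) ` X = parity_changes a b"
    proof -
      have "(\<lambda>k. a' * k mod b) ` X
          = {m \<in> (\<lambda>k. a' * k mod b) ` {1..<b}. even (a * m mod b) \<noteq> even m}"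
        unfolding X_def by auto
      then show ?thesis using bij unfolding parity_changes_def by (simp only: bij_betw_def)
    qed
  qed (auto simp: X_def)
  then have cX: "card X = card (parity_changes a b)" by (rule bij_betw_same_card)
  have "a * a' * k mod b = a * (a' * k mod b) mod b" for k
    by (simp add: mod_mult_right_eq mult.assoc)
  then have "parity_changes (a * a') b = (X - Y) \<union> (Y - X)"
    unfolding X_def Y_def parity_changes_def by auto
  then have "card (parity_changes (a * a') b) = card (X - Y) + card (Y - X)"
    using fin by (simp only:, intro card_Un_disjoint) auto
  moreover have "card X = card (X - Y) + card (X \<inter> Y)" "card Y = card (Y - X) + card (X \<inter> Y)"
    using card_Int_Diff[OF fin(1), of Y] card_Int_Diff[OF fin(2), of X] by (simp_all add: Int_commute)
  moreover have "even (card (X \<inter> Y))"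
  proof (rule even_card_reflection[OF assms(1)])
    fix k assume k: "k \<in> X \<inter> Y"
    then have kb: "k \<in> {1..<b}" by (auto simp: X_def)
    then have kb': "b - k \<in> {1..<b}" by auto
    have "coprime (a * a') b" using assms by simp
    note * = even_reflection[OF assms(1,2) this kb] even_reflection[OF assms(1,2,4) kb]
    have "a * (a' * k mod b) mod b = a * a' * k mod b" for k
      by (simp add: mod_mult_right_eq mult.assoc)
    then show "b - k \<in> X \<inter> Y"
      using k * kb' assms(1) by (auto simp: X_def Y_def parity_changes_def)
  qed (auto simp: X_def)
  ultimately have "card (parity_changes (a * a') b) + 2 * card (X \<inter> Y) = card X + card Y"
    "4 dvd 2 * card (X \<inter> Y)" by (auto elim!: evenE)
  moreover from this(2) obtain t where "2 * card (X \<inter> Y) = 4 * t" by (rule dvdE)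
  ultimately have eq: "card X + card Y = card (parity_changes (a * a') b) + 4 * t" by simp
  show ?thesis unfolding cX[symmetric] Y_def[symmetric] eq by (simp add: cong_def)
qed

text \<open>Odd squares are 1 modulo 8. Polarization expresses twice each product by squares; since
  the two sums of squares agree, the 2 cancels exactly and no precision modulo 8 is lost.\<close>

lemma dnum_mod_8:
  assumes "odd b" "b > 0" "coprime a b"
  shows "[b * dnum a b = 3 * (b - 1 - 2 * int (card (parity_changes a b)))] (mod 8)"
proof -
  define r where "r k = a * k mod b" for k
  have sq: "[(2 * k - b)\<^sup>2 = 1] (mod 8)" for k
  proof -
    obtain m where "b = 2 * m + 1" using assms(1) oddE by blast
    then have "(2 * k - b)\<^sup>2 - 1 = 4 * ((k - m) * (k - m - 1))"
      by (simp add: algebra_simps power2_eq_square)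
    moreover have "even ((k - m) * (k - m - 1))" by auto
    then obtain t where "(k - m) * (k - m - 1) = 2 * t" by blast
    ultimately have "(2 * k - b)\<^sup>2 - 1 = 8 * t" by simp
    then have "8 dvd (2 * k - b)\<^sup>2 - 1" by simp
    then show ?thesis by (simp add: cong_iff_dvd_diff)
  qed
  have diff: "[2 * (r k - k)\<^sup>2 = (if even (r k) \<noteq> even k then 2 else 0)] (mod 8)" for k
  proof (cases "even (r k) = even k")
    case True
    then have "even (r k - k)" by simp
    then obtain m where "r k - k = 2 * m" by blast
    then show ?thesis using True by (simp add: cong_def power2_eq_square)
  next
    case False
    then have "odd (r k - k)" by simp
    then obtain m where m: "r k - k = 2 * m + 1" by (blast elim: oddE)
    have eq: "2 * (r k - k)\<^sup>2 = 2 + 8 * (m * m + m)"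
      unfolding m by (simp add: algebra_simps power2_eq_square)
    have "[2 * (r k - k)\<^sup>2 = 2] (mod 8)" unfolding eq cong_def by (rule mod_mult_self2)
    then show ?thesis using False by simp
  qed
  have "(2 * k - b) * (2 * r k - b) * 2 = (2 * k - b)\<^sup>2 + (2 * r k - b)\<^sup>2 - 2 * (2 * (r k - k)\<^sup>2)" for k
    by (simp add: algebra_simps power2_eq_square)
  then have "(\<Sum>k = 1..<b. (2 * k - b) * (2 * r k - b) * 2)
      = (\<Sum>k = 1..<b. (2 * k - b)\<^sup>2 + (2 * r k - b)\<^sup>2 - 2 * (2 * (r k - k)\<^sup>2))"
    by (intro sum.cong refl)
  then have "2 * (\<Sum>k = 1..<b. (2 * k - b) * (2 * r k - b))
      = (\<Sum>k = 1..<b. (2 * k - b)\<^sup>2) + (\<Sum>k = 1..<b. (2 * r k - b)\<^sup>2)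
        - 2 * (\<Sum>k = 1..<b. 2 * (r k - k)\<^sup>2)"
    unfolding sum_distrib_right[symmetric] sum_subtractf sum.distrib sum_distrib_left[symmetric]
    by (simp only: mult.commute)
  then have "(\<Sum>k = 1..<b. (2 * k - b) * (2 * r k - b))
      = (\<Sum>k = 1..<b. (2 * k - b)\<^sup>2) - (\<Sum>k = 1..<b. 2 * (r k - k)\<^sup>2)"
    using sum_mult_mod[OF assms(3,2), of "\<lambda>k. (2 * k - b)\<^sup>2"] unfolding r_def by simp
  also have "[\<dots> = (\<Sum>k = 1..<b. 1) - (\<Sum>k = 1..<b. if even (r k) \<noteq> even k then 2 else 0)] (mod 8)"
    by (intro cong_diff cong_sum sq diff)
  also have "(\<Sum>k = 1..<b. if even (r k) \<noteq> even k then 2 else 0 :: int)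
      = 2 * int (card (parity_changes a b))"
    unfolding parity_changes_def r_def
    by (subst sum.inter_filter[symmetric]) auto
  also have "(\<Sum>k = 1..<b. 1 :: int) = b - 1" using assms by simp
  finally show ?thesis
    unfolding dnum_centered[OF assms(3,2)] r_def by (rule cong_scalar_left)
qed

lemma dnum_odd_mod_4:
  assumes "odd b" "b > 0" "coprime a b"
  shows "[dnum a b = b - 1] (mod 4)"
proof -
  obtain m where "card (parity_changes a b) = 2 * m"
    using even_card_parity_changes[OF assms] by blast
  then have "[b * dnum a b = 3 * (b - 1 - 4 * int m)] (mod 4)"
    using dnum_mod_8[OF assms] cong_modulus_mult[of _ _ 4 2] by simp
  \<comment> \<open>As \<open>b\<close> is its own inverse modulo 4, a second factor
    \<open>b\<close> undoes the first.\<close>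
  then have "[b * (b * dnum a b) = b * (3 * (b - 1 - 4 * int m))] (mod 4)"
    by (rule cong_scalar_left)
  then have "4 dvd b * (b * dnum a b) - b * (3 * (b - 1 - 4 * int m))"
    by (simp add: cong_iff_dvd_diff)
  moreover obtain n where n: "b = 2 * n + 1" using assms(1) oddE by blast
  have "dnum a b - (b - 1) = (b * (b * dnum a b) - b * (3 * (b - 1 - 4 * int m)))
      + 4 * (n * (3 * n + 1) - 3 * b * int m - (n * n + n) * dnum a b)"
    unfolding n by (simp add: algebra_simps)
  ultimately have "4 dvd dnum a b - (b - 1)" by simp
  then show ?thesis by (simp add: cong_iff_dvd_diff)
qed

text \<open>Multiplying by \<open>s\<close> twice adds twice an even number of parity changes, which
  is 0 modulo 4.\<close>

lemma dnum_mult_square_mod_8: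
  assumes "odd b" "b > 0" "coprime a b" "coprime s b"
  shows "[dnum (a * s\<^sup>2) b = dnum a b] (mod 8)"
proof -
  have co: "coprime (s * s) b" "coprime (a * (s * s)) b" using assms by simp_all
  have "[card (parity_changes (a * (s * s)) b) = card (parity_changes a b)
      + (card (parity_changes s b) + card (parity_changes s b))] (mod 4)"
    using card_parity_changes_mult[OF assms(1,2,3) co(1)] card_parity_changes_mult[OF assms(1,2,4,4)]
    by (meson cong_add cong_refl cong_trans)
  moreover obtain m where "card (parity_changes s b) = 2 * m"
    using even_card_parity_changes[OF assms(1,2,4)] by blast
  ultimately have "[card (parity_changes (a * (s * s)) b) = card (parity_changes a b)] (mod 4)"
    by (simp add: cong_def)
  then have "[int (card (parity_changes (a * (s * s)) b)) = int (card (parity_changes a b))] (mod 4)"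
    using cong_int_iff[of _ _ 4] by simp
  then obtain t where "int (card (parity_changes (a * (s * s)) b)) - int (card (parity_changes a b)) = 4 * t"
    unfolding cong_iff_dvd_diff by (rule dvdE)
  then have eq: "2 * int (card (parity_changes (a * (s * s)) b)) = 2 * int (card (parity_changes a b)) + 8 * t"
    by simp
  have "[2 * int (card (parity_changes (a * (s * s)) b)) = 2 * int (card (parity_changes a b))] (mod 8)"
    unfolding eq cong_def by (rule mod_mult_self2)
  then have "[b * dnum (a * (s * s)) b = b * dnum a b] (mod 8)"
    using dnum_mod_8[OF assms(1,2,3)] dnum_mod_8[OF assms(1,2) co(2)]
    by (meson cong_diff cong_refl cong_scalar_left cong_sym cong_trans)
  moreover have "coprime b (8 :: int)"
    using assms(1) coprime_power_right_iff[of b 2 3] by simp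
  ultimately show ?thesis by (simp add: cong_mult_lcancel power2_eq_square)
qed

section \<open>The Rademacher function\<close>

text \<open>For \<open>c = 0\<close> a unimodular matrix is a translation up to sign, and the value
  is its displacement. For \<open>c < 0\<close> the sign and the absolute value make \<Phi> agree at
  a matrix and its negative.\<close>

definition rademacher :: "int \<Rightarrow> int \<Rightarrow> int \<Rightarrow> int \<Rightarrow> real" where
  "rademacher a b c d = (if c = 0 then of_int b / of_int d
     else of_int (a + d) / of_int c - of_int (sgn c) * dsum d \<bar>c\<bar>)"

section \<open>Behaviour under generators, negation and inversion\<close>

lemma unimodular_coprime:
  fixes a b c d :: int
  assumes "a * d - b * c = 1"
  shows "coprime d c" "coprime a c" "coprime d \<bar>c\<bar>" "coprime a \<bar>c\<bar>"
proof -
  have "is_unit e" if "e dvd c" "e dvd a \<or> e dvd d" for e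
  proof -
    have "e dvd a * d - b * c" using that by auto
    then show ?thesis using assms by simp
  qed
  then show "coprime d c" "coprime a c" by (auto intro!: coprimeI simp del: zdvd1_eq)
  then show "coprime d \<bar>c\<bar>" "coprime a \<bar>c\<bar>" by simp_all
qed

lemma rademacher_mult_T:
  assumes "a * d - b * c = 1"
  shows "rademacher a (b + a * n) c (d + c * n) = rademacher a b c d + of_int n"
proof (cases "c = 0")
  case True
  then have "a * d = 1" using assms by simp
  then have "a = d" "d \<noteq> 0" by (auto simp: zmult_eq_1_iff)
  then show ?thesis using True by (simp add: rademacher_def field_simps)
next
  case False
  have "[d = d + c * n] (mod \<bar>c\<bar>)" by (simp add: cong_iff_dvd_diff)
  then have "dsum (d + c * n) \<bar>c\<bar> = dsum d \<bar>c\<bar>"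
    using False dsum_cong[OF unimodular_coprime(3)[OF assms]] by simp
  then show ?thesis using False by (simp add: rademacher_def field_simps)
qed

lemma dsum_sgn_abs:
  assumes "coprime a b" "b > 0" "a \<noteq> 0"
  shows "dsum a b = of_int (sgn a) * dsum \<bar>a\<bar> b"
  using dsum_uminus[OF assms(1,2)] assms(3) by (auto simp: abs_if sgn_if)

text \<open>Right multiplication by the generator of order 4 amounts to Dedekind reciprocity, whose
  constant \<open>- 3\<close> becomes the sign term.\<close>

lemma rademacher_mult_S:
  assumes "a * d - b * c = 1"
  shows "rademacher b (- a) d (- c) = rademacher a b c d - 3 * of_int (sgn (c * d))"
proof (cases "c = 0 \<or> d = 0")
  case True
  then show ?thesis
  proof
    assume c: "c = 0"
    then have "d = 1 \<or> d = -1" using assms by (auto simp: zmult_eq_1_iff)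
    then show ?thesis using c by (auto simp: rademacher_def)
  next
    assume d: "d = 0"
    then have "b * c = - 1" using assms by simp
    then have "c = 1 \<or> c = -1" by (metis assms d mult_minus_left mult_zero_right zmult_eq_1_iff minus_minus diff_0)
    then show ?thesis using d by (auto simp: rademacher_def)
  qed
next
  case False
  then have nz: "c \<noteq> 0" "d \<noteq> 0" by auto
  note co = unimodular_coprime[OF assms]
  \<comment> \<open>Reciprocity applies to the absolute values of \<open>c\<close> and
    \<open>d\<close>; the sign \<open>e\<close> of \<open>c * d\<close> carries it over to the
    signed entries.\<close>
  define e :: real where "e = of_int (sgn c) * of_int (sgn d)"
  have co': "coprime c \<bar>d\<bar>" "coprime \<bar>d\<bar> \<bar>c\<bar>" "coprime \<bar>c\<bar> \<bar>d\<bar>"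
    using co by (simp_all add: coprime_commute)
  have 1: "of_int (sgn c) * dsum d \<bar>c\<bar> = e * dsum \<bar>d\<bar> \<bar>c\<bar>"
    using dsum_sgn_abs[OF co(3) _ nz(2)] nz by (simp add: e_def)
  have 2: "of_int (sgn d) * dsum (- c) \<bar>d\<bar> = - e * dsum \<bar>c\<bar> \<bar>d\<bar>"
    using dsum_uminus[OF co'(1)] dsum_sgn_abs[OF co'(1) _ nz(1)] nz by (simp add: e_def)
  have "e * (dsum \<bar>c\<bar> \<bar>d\<bar> + dsum \<bar>d\<bar> \<bar>c\<bar>)
      = e * ((of_int c ^ 2 + of_int d ^ 2 + 1) / (\<bar>of_int c\<bar> * \<bar>of_int d\<bar>) - 3)"
    using dsum_reciprocity[OF co'(3)] nz by simp
  also have "\<dots> = e * ((of_int c ^ 2 + of_int d ^ 2 + 1) / (\<bar>of_int c\<bar> * \<bar>of_int d\<bar>)) - 3 * e"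
    by (simp only: right_diff_distrib mult.commute)
  also have "e * ((of_int c ^ 2 + of_int d ^ 2 + 1) / (\<bar>of_int c\<bar> * \<bar>of_int d\<bar>))
      = (of_int c ^ 2 + of_int d ^ 2 + 1) / (of_int c * of_int d)"
    using nz by (auto simp: e_def sgn_if abs_if field_simps)
  finally have 3: "e * (dsum \<bar>c\<bar> \<bar>d\<bar> + dsum \<bar>d\<bar> \<bar>c\<bar>)
      = (of_int c ^ 2 + of_int d ^ 2 + 1) / (of_int c * of_int d) - 3 * e" .
  have "real_of_int (a * d - b * c) = 1" using assms by simp
  then have "(of_int c ^ 2 + of_int d ^ 2 + 1) / (of_int c * of_int d) + (of_int b - of_int c) / of_int d
      = (of_int a + of_int d) / real_of_int c"
    using nz by (simp add: field_simps power2_eq_square)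
  moreover have "rademacher b (- a) d (- c) = (of_int b - of_int c) / of_int d + e * dsum \<bar>c\<bar> \<bar>d\<bar>"
    using nz 2 by (simp add: rademacher_def)
  moreover have "rademacher a b c d = (of_int a + of_int d) / of_int c - e * dsum \<bar>d\<bar> \<bar>c\<bar>"
    using nz 1 by (simp add: rademacher_def)
  moreover have "of_int (sgn (c * d)) = e" by (simp add: e_def sgn_mult)
  ultimately show ?thesis using 3 by (simp add: algebra_simps)
qed

lemma rademacher_uminus:
  assumes "a * d - b * c = 1"
  shows "rademacher (- a) (- b) (- c) (- d) = rademacher a b c d"
proof (cases "c = 0")
  case False
  have "real_of_int (- a + - d) / of_int (- c) = of_int (a + d) / of_int c"
    using False by (simp add: field_simps)
  then show ?thesis
    using dsum_uminus[OF unimodular_coprime(3)[OF assms]] False by (simp add: rademacher_def sgn_minus)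
qed (simp add: rademacher_def)

lemma rademacher_inverse:
  assumes "a * d - b * c = 1"
  shows "rademacher d (- b) (- c) a = - rademacher a b c d"
proof (cases "c = 0")
  case True
  then have "a = d" using assms by (auto simp: zmult_eq_1_iff)
  then show ?thesis using True by (simp add: rademacher_def)
next
  case False
  have "[a * d = 1] (mod \<bar>c\<bar>)"
    using assms by (metis cong_iff_dvd_diff abs_dvd_iff diff_eq_eq add_diff_cancel_left' dvd_triv_right)
  then have "dsum a \<bar>c\<bar> = dsum d \<bar>c\<bar>" using False by (intro dsum_inverse) auto
  then show ?thesis using False by (simp add: rademacher_def sgn_minus field_simps)
qed

text \<open>This reconciles the sign terms in the induction for \<open>rademacher_mult\<close>. Only
  signs matter: those of the four entries fix the sign of \<open>u\<close> unless
  \<open>x * w\<close> and \<open>y * v\<close> have the same nonzero sign, and then the terms with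
  \<open>u\<close> cancel.\<close>

lemma sgn_cocycle:
  fixes u v w x y :: int
  assumes "x * w - y * v = u" "x \<noteq> 0 \<or> y \<noteq> 0" "v \<noteq> 0 \<or> w \<noteq> 0"
  shows "sgn (u * v * x) + sgn (x * y) = sgn (v * w) + sgn (u * w * y)"
proof -
  have mono: "sgn s \<le> sgn t" if "s \<le> t" for s t :: int using that by (auto simp: sgn_if)
  have u: "sgn x * sgn w = sgn y * sgn v \<and> sgn x * sgn w \<noteq> 0 \<or> sgn u = sgn (sgn x * sgn w - sgn y * sgn v)"
  proof (cases "sgn (x * w) = sgn (y * v)")
    case False
    show ?thesis
    proof (cases "x * w < y * v")
      case True
      then have "sgn (x * w) < sgn (y * v)" using False mono[of "x * w" "y * v"] by simp
      then have "sgn (sgn x * sgn w - sgn y * sgn v) = -1" by (simp add: sgn_1_neg sgn_mult)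
      moreover have "sgn u = -1" using True assms(1) by (simp add: sgn_1_neg)
      ultimately show ?thesis by simp
    next
      case f: False
      then have "sgn (y * v) < sgn (x * w)" using False mono[of "y * v" "x * w"] by simp
      then have "sgn (sgn x * sgn w - sgn y * sgn v) = 1" by (simp add: sgn_1_pos sgn_mult)
      moreover have "y * v < x * w" using f False by (metis linorder_neqE)
      then have "sgn u = 1" using assms(1) by (simp add: sgn_1_pos)
      ultimately show ?thesis by simp
    qed
  next
    case True
    then have e: "sgn x * sgn w = sgn y * sgn v" by (simp add: sgn_mult)
    show ?thesis
    proof (cases "x * w = 0")
      case xw: True
      then have yv: "y * v = 0" using True by (metis sgn_0_0)
      have "u = 0" using assms(1) unfolding xw yv by simp
      then show ?thesis using e by simp
    next
      case False
      then have "sgn x * sgn w \<noteq> 0" by (simp add: sgn_0_0)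
      then show ?thesis using e by blast
    qed
  qed
  have key: "U * V * X + X * Y = V * W + U * W * Y"
    if "X \<in> {-1, 0, 1}" "Y \<in> {-1, 0, 1}" "V \<in> {-1, 0, 1}" "W \<in> {-1, 0, 1}"
      "X \<noteq> 0 \<or> Y \<noteq> 0" "V \<noteq> 0 \<or> W \<noteq> 0" "X * W = Y * V \<and> X * W \<noteq> 0 \<or> U = sgn (X * W - Y * V)"
    for U V W X Y :: int
    using that by auto
  have sgn: "sgn t \<in> {-1, 0, 1}" for t :: int by (auto simp: sgn_if)
  have "sgn x \<noteq> 0 \<or> sgn y \<noteq> 0" "sgn v \<noteq> 0 \<or> sgn w \<noteq> 0"
    using assms(2,3) by (simp_all add: sgn_0_0)
  then show ?thesis
    unfolding sgn_mult by (rule key[OF sgn sgn sgn sgn _ _ u])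
qed

text \<open>Induction on \<open>\<bar>c'\<bar>\<close>: the Euclidean algorithm writes the second factor as a product of
  the generators of the modular group, for which the formula is periodicity and reciprocity.\<close>

theorem rademacher_mult:
  assumes "a * d - b * c = 1" "a' * d' - b' * c' = 1"
  shows "rademacher (a * a' + b * c') (a * b' + b * d') (c * a' + d * c') (c * b' + d * d')
    = rademacher a b c d + rademacher a' b' c' d' - 3 * of_int (sgn (c * c' * (c * a' + d * c')))"
  using assms(2)
proof (induction "nat \<bar>c'\<bar>" arbitrary: a' b' c' d' rule: less_induct)
  case less
  show ?case
  proof (cases "c' = 0")
    case True
    then have "d' = 1 \<and> a' = 1 \<or> d' = -1 \<and> a' = -1"
      using less.prems by (auto simp: zmult_eq_1_iff)
    then show ?thesis
    proof
      assume "d' = 1 \<and> a' = 1"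
      then show ?thesis using True rademacher_mult_T[OF assms(1), of b'] by (simp add: rademacher_def[of 1] algebra_simps)
    next
      assume d: "d' = -1 \<and> a' = -1"
      have "(- a) * (- d) - (- b) * (- c) = 1" using assms(1) by simp
      from rademacher_mult_T[OF this, of "- b'"] rademacher_uminus[OF assms(1)] d True show ?thesis
        by (simp add: rademacher_def[of "-1"] algebra_simps)
    qed
  next
    case False
    \<comment> \<open>One Euclidean step on the lower row: the second factor is the matrix with rows
      \<open>(- b1, a')\<close> and \<open>(- r, c')\<close>, multiplied on the right by S and then
      T^n. Below, \<open>(p, s)\<close> and \<open>(x, y)\<close> are the rows of the first factor
      times that smaller matrix.\<close>
    define n where "n = d' div c'"
    define r where "r = d' mod c'"
    define b1 where "b1 = b' - n * a'"
    have d': "d' = r + c' * n" by (simp add: n_def r_def)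
    have b': "b' = b1 + a' * n" by (simp add: b1_def)
    have det1: "a' * r - b1 * c' = 1" using less.prems by (simp add: d' b' algebra_simps)
    then have det2: "(- b1) * c' - a' * (- r) = 1" by simp
    have "nat \<bar>- r\<bar> < nat \<bar>c'\<bar>"
      using False abs_mod_less[of c' d'] by (simp add: r_def)
    note IH = less.hyps[OF this det2]
    define x where "x = c * (- b1) + d * (- r)"
    define y where "y = c * a' + d * c'"
    define p where "p = a * (- b1) + b * (- r)"
    define s where "s = a * a' + b * c'"
    have det3: "p * y - s * x = 1"
    proof -
      have "p * y - s * x = (a * d - b * c) * ((- b1) * c' - a' * (- r))"
        unfolding p_def y_def s_def x_def by (simp add: algebra_simps)
      then show ?thesis using assms(1) det2 by simp
    qed
    then have det4: "s * (- x) - (- p) * y = 1" by (simp add: algebra_simps)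
    have "rademacher (a * a' + b * c') (a * b' + b * d') (c * a' + d * c') (c * b' + d * d')
        = rademacher s (- p + s * n) y (- x + y * n)"
      by (simp add: s_def p_def x_def y_def d' b' algebra_simps)
    also have "\<dots> = rademacher p s x y - 3 * of_int (sgn (x * y)) + of_int n"
      using rademacher_mult_T[OF det4, of n] rademacher_mult_S[OF det3] by simp
    also have "rademacher p s x y = rademacher a b c d + rademacher (- b1) a' (- r) c' - 3 * of_int (sgn (c * (- r) * x))"
      using IH by (simp add: p_def s_def x_def y_def)
    finally have 1: "rademacher (a * a' + b * c') (a * b' + b * d') (c * a' + d * c') (c * b' + d * d')
        = rademacher a b c d + rademacher (- b1) a' (- r) c' + of_int n
          - 3 * of_int (sgn (c * (- r) * x) + sgn (x * y))" by simp
    have 2: "rademacher a' b' c' d' = rademacher (- b1) a' (- r) c' - 3 * of_int (sgn (- r * c')) + of_int n"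
      using rademacher_mult_T[OF det1, of n] rademacher_mult_S[OF det2] by (simp add: d' b')
    have "x * c' - y * (- r) = c"
    proof -
      have "x * c' - y * (- r) = c * ((- b1) * c' - a' * (- r))"
        unfolding x_def y_def by (simp add: algebra_simps)
      then show ?thesis using det2 by simp
    qed
    moreover have "x \<noteq> 0 \<or> y \<noteq> 0" using det3 by auto
    ultimately have "sgn (c * (- r) * x) + sgn (x * y) = sgn (- r * c') + sgn (c * c' * y)"
      using False by (intro sgn_cocycle) auto
    then show ?thesis using 1 2 by (simp add: y_def)
  qed
qed

text \<open>Multiplied by the unit \<open>d\<close> modulo \<open>c\<close>, the numerator
  \<open>a + d - dnum d c\<close> becomes \<open>1 + d\<^sup>2 - d * dnum d c\<close>, which is 0 by
  \<open>dnum_mult_cong\<close>.\<close>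

lemma rademacher_in_Ints:
  assumes "a * d - b * c = 1" "c > 0"
  shows "rademacher a b c d \<in> \<int>"
proof -
  note co = unimodular_coprime[OF assms(1)]
  have "c dvd d * dnum d c - (d\<^sup>2 + 1)"
    using dnum_mult_cong[OF co(1) assms(2)] by (simp add: cong_iff_dvd_diff)
  moreover have "d * (a + d - dnum d c) = b * c - (d * dnum d c - (d\<^sup>2 + 1))"
    using assms(1) by (simp add: algebra_simps power2_eq_square)
  ultimately have "c dvd d * (a + d - dnum d c)" by simp
  then have "c dvd a + d - dnum d c"
    using co(1) by (simp add: coprime_dvd_mult_right_iff coprime_commute)
  then obtain m where m: "a + d - dnum d c = c * m" by blast
  have "of_int c * rademacher a b c d = of_int (a + d) - of_int c * dsum d c"
    using assms(2) by (simp add: rademacher_def field_simps)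
  also have "\<dots> = of_int (c * m)"
    using dsum_eq_dnum[OF co(1) assms(2)] by (simp flip: m)
  finally have "rademacher a b c d = of_int m" using assms(2) by simp
  then show ?thesis by simp
qed

section \<open>Values of the Rademacher function and their periods\<close>

text \<open>The set \<open>P\<close> of the overview. Taking \<open>c > 0\<close> loses nothing:
  \<open>c = 0\<close> contradicts the determinant, and negating the matrix makes a negative
  \<open>c\<close> positive and preserves \<Phi>.\<close>

definition rademacher_values :: "int \<Rightarrow> int set" where
  "rademacher_values q = {p. \<exists>b c d. c > 0 \<and> - q\<^sup>2 * d * d - b * c = 1 \<and> of_int p = rademacher (- q\<^sup>2 * d) b c d}"

lemma rademacher_values_iff:
  "p \<in> rademacher_values q \<longleftrightarrow> (\<exists>c d. c > 0 \<and> c dvd q\<^sup>2 * d\<^sup>2 + 1 \<and>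
     of_int p = of_int ((1 - q\<^sup>2) * d) / of_int c - dsum d c)"
proof -
  have "c dvd q\<^sup>2 * d\<^sup>2 + 1 \<longleftrightarrow> (\<exists>b. - q\<^sup>2 * d * d - b * c = 1)" for c d
  proof
    assume "c dvd q\<^sup>2 * d\<^sup>2 + 1"
    then obtain m where "q\<^sup>2 * d\<^sup>2 + 1 = c * m" by blast
    then have "- q\<^sup>2 * d * d - (- m) * c = 1" by (simp add: algebra_simps power2_eq_square)
    then show "\<exists>b. - q\<^sup>2 * d * d - b * c = 1" by blast
  next
    assume "\<exists>b. - q\<^sup>2 * d * d - b * c = 1"
    then obtain b where "- q\<^sup>2 * d * d - b * c = 1" by blast
    then have "q\<^sup>2 * d\<^sup>2 + 1 = c * (- b)" by (simp add: algebra_simps power2_eq_square)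
    then show "c dvd q\<^sup>2 * d\<^sup>2 + 1" by (metis dvd_triv_left)
  qed
  moreover have "rademacher (- q\<^sup>2 * d) b c d = of_int ((1 - q\<^sup>2) * d) / of_int c - dsum d c" if "c > 0" for b c d
    using that by (simp add: rademacher_def algebra_simps)
  ultimately show ?thesis unfolding rademacher_values_def mem_Collect_eq by (metis (no_types, lifting))
qed

lemma zero_in_rad_values: "0 \<in> rademacher_values q"
  unfolding rademacher_values_iff by (intro exI[of _ 1] exI[of _ 0]) simp

lemma coprime_of_dvd_square:
  fixes c d q :: int
  assumes "c dvd q\<^sup>2 * d\<^sup>2 + 1"
  shows "coprime q c" "coprime d c" "coprime (q * d) c"
proof -
  have "coprime (q\<^sup>2 * d\<^sup>2) (q\<^sup>2 * d\<^sup>2 + 1)" by (rule coprime_add_one_right)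
  then have "coprime (q\<^sup>2 * d\<^sup>2) c" using assms coprime_divisors dvd_refl by blast
  then show "coprime q c" "coprime d c" "coprime (q * d) c" by simp_all
qed

lemma rademacher_values_dnum:
  assumes "c > 0" "c dvd q\<^sup>2 * d\<^sup>2 + 1" "of_int p = of_int ((1 - q\<^sup>2) * d) / of_int c - dsum d c"
  shows "c * p = (1 - q\<^sup>2) * d - dnum d c"
proof -
  have "real_of_int (c * p) = of_int ((1 - q\<^sup>2) * d) - of_int c * dsum d c"
    using assms(1) by (simp add: assms(3) field_simps)
  also have "\<dots> = of_int ((1 - q\<^sup>2) * d - dnum d c)"
    using dsum_eq_dnum[OF coprime_of_dvd_square(2)[OF assms(2)] assms(1)] by simp
  finally show ?thesis by linarith
qed

lemma rademacher_values_exists: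
  assumes "c > 0" "c dvd q\<^sup>2 * d\<^sup>2 + 1"
  obtains p where "p \<in> rademacher_values q" "of_int p = of_int ((1 - q\<^sup>2) * d) / of_int c - dsum d c"
    "c * p = (1 - q\<^sup>2) * d - dnum d c"
proof -
  obtain m where "q\<^sup>2 * d\<^sup>2 + 1 = c * m" using assms(2) by blast
  then have "(- q\<^sup>2 * d) * d - (- m) * c = 1" by (simp add: algebra_simps power2_eq_square)
  from rademacher_in_Ints[OF this assms(1)]
  obtain p where "rademacher (- q\<^sup>2 * d) (- m) c d = of_int p" by (auto elim: Ints_cases)
  then have "of_int p = of_int ((1 - q\<^sup>2) * d) / of_int c - dsum d c"
    using assms(1) by (simp add: rademacher_def algebra_simps)
  then show ?thesis using that rademacher_values_dnum[OF assms] rademacher_values_iff assms by blast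
qed

section \<open>The group of translations preserving a set of integers\<close>

definition periods :: "int set \<Rightarrow> int set" where
  "periods P = {m. \<forall>p. p \<in> P \<longleftrightarrow> p + m \<in> P}"

lemma zero_in_periods: "0 \<in> periods P"
  by (simp add: periods_def)

lemma periods_add: "m \<in> periods P \<Longrightarrow> n \<in> periods P \<Longrightarrow> m + n \<in> periods P"
  unfolding periods_def by (auto simp: add.assoc[symmetric])

lemma periods_uminus: "m \<in> periods P \<Longrightarrow> - m \<in> periods P"
  unfolding periods_def mem_Collect_eq by (metis diff_add_cancel uminus_add_conv_diff add.commute)

lemma periods_mult:
  assumes "m \<in> periods P"
  shows "m * n \<in> periods P"
proof -
  have "m * int k \<in> periods P" for k
    by (induction k) (use assms in \<open>auto simp: zero_in_periods algebra_simps intro: periods_add\<close>)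
  from this[of "nat n"] periods_uminus[OF this[of "nat (- n)"]] show ?thesis
    by (cases "n \<ge> 0") simp_all
qed

lemma periods_dvd: "m \<in> periods P \<Longrightarrow> m dvd n \<Longrightarrow> n \<in> periods P"
  using periods_mult by (auto elim!: dvdE)

lemma periods_gcd:
  assumes "m \<in> periods P" "n \<in> periods P"
  shows "gcd m n \<in> periods P"
proof -
  obtain u v where "u * m + v * n = gcd m n" using bezout_int by blast
  then show ?thesis
    using periods_add periods_mult assms by (metis mult.commute)
qed

lemma periodsI:
  assumes "\<And>p. p \<in> P \<Longrightarrow> p + m \<in> P" "\<And>p. p \<in> P \<Longrightarrow> p - m \<in> P"
  shows "m \<in> periods P"
  unfolding periods_def mem_Collect_eq using assms by (metis add_diff_cancel_right')

text \<open>Replacing \<open>d\<close> by \<open>d - c * n\<close> preserves the divisibility and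
  the Dedekind sum, and shifts the rational term by \<open>(q\<^sup>2 - 1) * n\<close>.\<close>

lemma square_minus_1_period: "q\<^sup>2 - 1 \<in> periods (rademacher_values q)"
proof -
  have "p + (q\<^sup>2 - 1) * n \<in> rademacher_values q" if "p \<in> rademacher_values q" for p n
  proof -
    from that obtain c d where cd: "c > 0" "c dvd q\<^sup>2 * d\<^sup>2 + 1"
      "of_int p = of_int ((1 - q\<^sup>2) * d) / of_int c - dsum d c"
      unfolding rademacher_values_iff by blast
    define d' where "d' = d - c * n"
    have dd': "[d = d'] (mod c)" by (simp add: d'_def cong_iff_dvd_diff)
    have "q\<^sup>2 * d'\<^sup>2 + 1 = (q\<^sup>2 * d\<^sup>2 + 1) + c * (q\<^sup>2 * n * (c * n - 2 * d))"
      by (simp add: d'_def algebra_simps power2_eq_square)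
    then have "c dvd q\<^sup>2 * d'\<^sup>2 + 1" using cd(2) by (metis dvd_add dvd_triv_left)
    moreover have "of_int (p + (q\<^sup>2 - 1) * n) = of_int ((1 - q\<^sup>2) * d') / of_int c - dsum d' c"
      using cd dsum_cong[OF coprime_of_dvd_square(2)[OF cd(2)] cd(1) dd']
      by (simp add: d'_def field_simps)
    ultimately show ?thesis unfolding rademacher_values_iff using cd(1) by blast
  qed
  from this[of _ 1] this[of _ "-1"] show ?thesis
    by (intro periodsI) (simp_all only: mult_1_right mult_minus_right diff_conv_add_uminus)
qed

text \<open>The lower left entry of \<open>h M (X h X\<^sup>-\<^sup>1)\<^sup>-\<^sup>1\<close> is the value of a positive definite quadratic form
  at the lower row of \<open>h\<close>. As it is positive, like that of \<open>M\<close>, the sign terms of the two products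
  cancel.\<close>

lemma rademacher_values_conjugate:
  assumes "q > 0" "p \<in> rademacher_values q" "\<alpha> * \<epsilon> - q\<^sup>2 * \<beta> * \<gamma> = 1"
    and m: "of_int m = rademacher \<alpha> (q\<^sup>2 * \<beta>) \<gamma> \<epsilon> - rademacher \<alpha> \<beta> (q\<^sup>2 * \<gamma>) \<epsilon>"
  shows "p + m \<in> rademacher_values q"
proof -
  obtain b c d where M: "c > 0" "(- q\<^sup>2 * d) * d - b * c = 1" "of_int p = rademacher (- q\<^sup>2 * d) b c d"
    using assms(2) unfolding rademacher_values_def by auto
  \<comment> \<open>With \<open>h\<close> having rows \<open>(\<alpha>, q\<^sup>2 * \<beta>)\<close>
    and \<open>(\<gamma>, \<epsilon>)\<close>, these are the entries of \<open>h M\<close>;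
    conjugating \<open>h\<close> by \<open>X\<close> moves the factor \<open>q\<^sup>2\<close> from
    the upper right to the lower left.\<close>
  define a1 where "a1 = \<alpha> * (- q\<^sup>2 * d) + q\<^sup>2 * \<beta> * c"
  define b1 where "b1 = \<alpha> * b + q\<^sup>2 * \<beta> * d"
  define c1 where "c1 = \<gamma> * (- q\<^sup>2 * d) + \<epsilon> * c"
  define d1 where "d1 = \<gamma> * b + \<epsilon> * d"
  have det1: "\<alpha> * \<epsilon> - (q\<^sup>2 * \<beta>) * \<gamma> = 1" using assms(3) by simp
  have det2: "\<alpha> * \<epsilon> - \<beta> * (q\<^sup>2 * \<gamma>) = 1" using assms(3) by (simp add: algebra_simps)
  then have det3: "\<epsilon> * \<alpha> - (- \<beta>) * (- (q\<^sup>2 * \<gamma>)) = 1" by (simp add: algebra_simps)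
  have hM: "rademacher a1 b1 c1 d1 = rademacher \<alpha> (q\<^sup>2 * \<beta>) \<gamma> \<epsilon> + of_int p - 3 * of_int (sgn (\<gamma> * c * c1))"
    using rademacher_mult[OF det1 M(2)] M(3) by (simp add: a1_def b1_def c1_def d1_def)
  have "a1 * d1 - b1 * c1 = (\<alpha> * \<epsilon> - (q\<^sup>2 * \<beta>) * \<gamma>) * ((- q\<^sup>2 * d) * d - b * c)"
    unfolding a1_def b1_def c1_def d1_def by (simp add: algebra_simps)
  then have det4: "a1 * d1 - b1 * c1 = 1" using det1 M(2) by simp
  define c2 where "c2 = c1 * \<epsilon> + d1 * (- (q\<^sup>2 * \<gamma>))"
  define d2 where "d2 = c1 * (- \<beta>) + d1 * \<alpha>"
  define b2 where "b2 = a1 * (- \<beta>) + b1 * \<alpha>"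
  \<comment> \<open>The twist is what preserves the shape \<open>a = - q\<^sup>2 d\<close>.\<close>
  have a2: "a1 * \<epsilon> + b1 * (- (q\<^sup>2 * \<gamma>)) = - q\<^sup>2 * d2"
    unfolding a1_def b1_def c1_def d1_def d2_def by (simp add: algebra_simps)
  have N: "rademacher (- q\<^sup>2 * d2) b2 c2 d2 = rademacher a1 b1 c1 d1 + rademacher \<epsilon> (- \<beta>) (- (q\<^sup>2 * \<gamma>)) \<alpha>
      - 3 * of_int (sgn (c1 * (- (q\<^sup>2 * \<gamma>)) * c2))"
    using rademacher_mult[OF det4 det3] unfolding a2 by (simp add: c2_def d2_def b2_def)
  have "(- q\<^sup>2 * d2) * d2 - b2 * c2 = (a1 * \<epsilon> + b1 * (- (q\<^sup>2 * \<gamma>))) * d2 - b2 * c2"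
    by (simp only: a2)
  also have "\<dots> = (a1 * d1 - b1 * c1) * (\<epsilon> * \<alpha> - (- \<beta>) * (- (q\<^sup>2 * \<gamma>)))"
    unfolding b2_def c2_def d2_def by (simp add: algebra_simps)
  finally have det5: "(- q\<^sup>2 * d2) * d2 - b2 * c2 = 1" using det3 det4 by simp
  have "c * c2 = (c * \<epsilon> - q\<^sup>2 * \<gamma> * d)\<^sup>2 - (q\<^sup>2 * \<gamma>\<^sup>2) * (q\<^sup>2 * d * d + b * c)"
    unfolding c2_def c1_def d1_def by (simp add: algebra_simps power2_eq_square)
  also have "q\<^sup>2 * d * d + b * c = -1" using M(2) by simp
  finally have cc2: "c * c2 = (c * \<epsilon> - q\<^sup>2 * \<gamma> * d)\<^sup>2 + q\<^sup>2 * \<gamma>\<^sup>2" by simp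
  have "c * c2 > 0"
  proof (cases "\<gamma> = 0")
    case True
    then have "\<epsilon> \<noteq> 0" using assms(3) by auto
    then show ?thesis unfolding cc2 using True M(1) by simp
  next
    case False
    then show ?thesis unfolding cc2 using assms(1) by (simp add: add_nonneg_pos)
  qed
  then have c2: "c2 > 0" using M(1) by (simp add: zero_less_mult_iff)
  have "sgn (\<gamma> * c * c1) + sgn (c1 * (- (q\<^sup>2 * \<gamma>)) * c2) = 0"
    using M(1) c2 assms(1) by (simp add: sgn_mult sgn_minus)
  then have "3 * real_of_int (sgn (\<gamma> * c * c1)) + 3 * of_int (sgn (c1 * (- (q\<^sup>2 * \<gamma>)) * c2)) = 0"
    by (metis distrib_left mult_zero_right of_int_0 of_int_add)
  then have "of_int (p + m) = rademacher (- q\<^sup>2 * d2) b2 c2 d2"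
    unfolding N hM using m rademacher_inverse[OF det2] by simp
  then show ?thesis unfolding rademacher_values_def using c2 det5 by blast
qed

text \<open>The period comes from conjugation by a matrix with lower row \<open>(1, e)\<close>, where reciprocity
  evaluates \<open>\<Phi>(h) - \<Phi>(X h X\<^sup>-\<^sup>1)\<close>; it is multiplied by \<open>e\<close> and reduced modulo \<open>q\<^sup>2 - 1\<close> to get
  a formula involving only \<open>q\<^sup>2\<close> modulo \<open>e\<close>.\<close>

lemma reciprocity_period:
  assumes "q > 0" "e > 0" "coprime e q"
  shows "(e - 1) * (e - 2) - dnum (q\<^sup>2) e \<in> periods (rademacher_values q)"
proof -
  have coq: "coprime e (q\<^sup>2)" using assms(3) by simp
  obtain f where "[e * f = 1] (mod q\<^sup>2)"
    using coq cong_solve_coprime_int by blast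
  then obtain \<beta> where \<beta>: "f * e - q\<^sup>2 * \<beta> = 1"
    by (metis cong_iff_dvd_diff dvdE mult.commute diff_eq_eq diff_add_cancel add.commute)
  have det: "f * e - q\<^sup>2 * \<beta> * 1 = 1" "e * f - q\<^sup>2 * (- \<beta>) * (-1) = 1" using \<beta> by (simp_all add: algebra_simps)
  have det1: "f * e - (q\<^sup>2 * \<beta>) * 1 = 1" and det2: "f * e - \<beta> * q\<^sup>2 = 1" using \<beta> by (simp_all add: algebra_simps)
  have q2: "q\<^sup>2 > 0" using assms(1) by simp
  obtain m where m: "of_int m = rademacher f (q\<^sup>2 * \<beta>) 1 e - rademacher f \<beta> (q\<^sup>2) e"
    using rademacher_in_Ints[OF det1] rademacher_in_Ints[OF det2 q2] by (metis Ints_cases Ints_diff zero_less_one)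
  have "p + m \<in> rademacher_values q" if "p \<in> rademacher_values q" for p
    using rademacher_values_conjugate[OF assms(1) that det(1)] m by simp
  moreover have "p - m \<in> rademacher_values q" if "p \<in> rademacher_values q" for p
  proof -
    \<comment> \<open>The inverse of \<open>h\<close> realizes the opposite shift.\<close>
    have "of_int (- m) = rademacher e (q\<^sup>2 * - \<beta>) (-1) f - rademacher e (- \<beta>) (q\<^sup>2 * - 1) f"
      using m rademacher_inverse[OF det1] rademacher_inverse[OF det2] by simp
    from rademacher_values_conjugate[OF assms(1) that det(2) this] show ?thesis by simp
  qed
  ultimately have "m \<in> periods (rademacher_values q)" by (rule periodsI)
  \<comment> \<open>This multiple of \<open>q\<^sup>2 - 1\<close> is chosen to cancel
    \<open>\<beta>\<close> and the summand \<open>q\<^sup>2\<close> that reciprocity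
    produces.\<close>
  then have "m * e - (q\<^sup>2 - 1) * (\<beta> + 1) \<in> periods (rademacher_values q)"
    using periods_add[OF periods_mult periods_uminus[OF periods_mult]] square_minus_1_period
    by (metis diff_conv_add_uminus)
  moreover have "m * e - (q\<^sup>2 - 1) * (\<beta> + 1) = (e - 1) * (e - 2) - dnum (q\<^sup>2) e"
  proof -
    have "rademacher f \<beta> (q\<^sup>2) e = of_int (f + e) / of_int (q\<^sup>2) - dsum e (q\<^sup>2)"
      by (simp only: rademacher_def q2[THEN less_imp_neq, symmetric] if_False sgn_pos[OF q2]
        abs_of_pos[OF q2] of_int_1 mult_1)
    moreover have "rademacher f (q\<^sup>2 * \<beta>) 1 e = of_int (f + e)" by (simp add: rademacher_def)
    ultimately have meq: "of_int m = of_int (f + e) - (of_int (f + e) / of_int (q\<^sup>2) - dsum e (q\<^sup>2))"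
      using m by (simp only:)
    have "of_int (m * q\<^sup>2) = of_int (f + e) * of_int (q\<^sup>2 - 1) + of_int (q\<^sup>2) * dsum e (q\<^sup>2)"
      unfolding of_int_mult meq using assms(1) by (simp add: field_simps)
    also have "\<dots> = of_int ((f + e) * (q\<^sup>2 - 1) + dnum e (q\<^sup>2))"
      using dsum_eq_dnum[OF coq q2] by simp
    finally have "m * q\<^sup>2 = (f + e) * (q\<^sup>2 - 1) + dnum e (q\<^sup>2)" by linarith
    then have "e * (m * q\<^sup>2) = e * ((f + e) * (q\<^sup>2 - 1) + dnum e (q\<^sup>2))" by simp
    then have "q\<^sup>2 * (m * e) = (f * e + e\<^sup>2) * (q\<^sup>2 - 1) + e * dnum e (q\<^sup>2)"
      by (simp add: algebra_simps power2_eq_square)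
    also have "e * dnum e (q\<^sup>2) = e\<^sup>2 + (q\<^sup>2)\<^sup>2 + 1 - 3 * e * q\<^sup>2 - q\<^sup>2 * dnum (q\<^sup>2) e"
      using dnum_reciprocity[OF coq assms(2) q2] by simp
    also have "f * e = 1 + q\<^sup>2 * \<beta>" using \<beta> by simp
    finally have "q\<^sup>2 * (m * e - (q\<^sup>2 - 1) * (\<beta> + 1)) = q\<^sup>2 * ((e - 1) * (e - 2) - dnum (q\<^sup>2) e)"
      by (simp add: algebra_simps power2_eq_square)
    then show ?thesis using q2 by simp
  qed
  ultimately show ?thesis by simp
qed

section \<open>Congruences bounding the set of values from above\<close>

definition admissible :: "int \<Rightarrow> int \<Rightarrow> bool" where
  "admissible q p \<longleftrightarrow> (\<not> 3 dvd q \<longrightarrow> 3 dvd p) \<and> (odd q \<longrightarrow> 4 dvd p) \<and> (odd q \<and> is_square q \<longrightarrow> 8 dvd p)"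

lemma three_dvd_square_minus_1: "\<not> 3 dvd (q :: int) \<Longrightarrow> 3 dvd q\<^sup>2 - 1"
proof -
  assume "\<not> 3 dvd q"
  then have "3 dvd (q - 1) * (q + 1)"
  proof -
    have "3 dvd q - 1 \<or> 3 dvd q + 1" using \<open>\<not> 3 dvd q\<close> by presburger
    then show ?thesis by auto
  qed
  then show ?thesis by (simp add: algebra_simps power2_eq_square)
qed

lemma eight_dvd_square_minus_1: "odd (q :: int) \<Longrightarrow> 8 dvd q\<^sup>2 - 1"
proof -
  assume "odd q"
  then obtain n where n: "q = 2 * n + 1" by (blast elim: oddE)
  have "even (n * (n + 1))" by auto
  then obtain t where "n * (n + 1) = 2 * t" by blast
  then have "q\<^sup>2 - 1 = 8 * t" unfolding n by (simp add: algebra_simps power2_eq_square)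
  then show ?thesis by simp
qed

text \<open>Modulo \<open>b\<close> the inverse of \<open>x\<close> is \<open>- x\<close>, so
  \<open>dsum x b\<close> equals its own negative.\<close>

lemma dnum_eq_0:
  assumes "b > 0" "b dvd x\<^sup>2 + 1"
  shows "dnum x b = 0"
proof -
  have "[x * (- x) = 1] (mod b)"
    using assms(2) by (simp add: cong_iff_dvd_diff power2_eq_square flip: dvd_minus_iff[of b "x * x + 1"])
  then have "dsum x b = dsum (- x) b" using assms(1) by (rule dsum_inverse[rotated])
  moreover have co: "coprime x b"
    using \<open>[x * (- x) = 1] (mod b)\<close> coprime_iff_invertible_int by blast
  ultimately have "dsum x b = 0" using dsum_uminus[OF co assms(1)] by simp
  then show ?thesis using dsum_eq_dnum[OF co assms(1)] by simp
qed

text \<open>\<open>c\<close> and \<open>c'\<close> are inverse modulo \<open>d\<close>, so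
  \<open>dsum c d = dsum c' d\<close>; reciprocity on each side then leaves an expression symmetric
  in \<open>c\<close> and \<open>c'\<close>.\<close>

lemma rademacher_values_swap_pos:
  assumes "c > 0" "c' > 0" "d > 0" "c * c' = q\<^sup>2 * d\<^sup>2 + 1"
  shows "of_int ((1 - q\<^sup>2) * d) / of_int c - dsum d c = of_int ((1 - q\<^sup>2) * d) / of_int c' - dsum d c'"
proof -
  have co: "coprime d c" "coprime d c'"
    using coprime_of_dvd_square(2)[of c q d] coprime_of_dvd_square(2)[of c' q d] assms(4)
    by (metis dvd_triv_left dvd_triv_right)+
  have "[c * c' = 1] (mod d)"
    unfolding assms(4) by (simp add: cong_iff_dvd_diff power2_eq_square)
  then have eq: "dsum c d = dsum c' d" by (rule dsum_inverse[OF assms(3)])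
  have r: "dsum d c = (of_int d ^ 2 + of_int c ^ 2 + 1) / (of_int d * of_int c) - 3 - dsum c d"
    "dsum d c' = (of_int d ^ 2 + of_int c' ^ 2 + 1) / (of_int d * of_int c') - 3 - dsum c d"
    using dsum_reciprocity[OF co(1) assms(3,1)] dsum_reciprocity[OF co(2) assms(3,2)]
    by (simp_all add: eq)
  have "real_of_int c * of_int c' = of_int q ^ 2 * of_int d ^ 2 + 1"
    using arg_cong[OF assms(4), of real_of_int] by simp
  then have "(of_int ((1 - q\<^sup>2) * d) / of_int c - (of_int d ^ 2 + of_int c ^ 2 + 1) / (of_int d * of_int c))
    = of_int ((1 - q\<^sup>2) * d) / real_of_int c' - (of_int d ^ 2 + of_int c' ^ 2 + 1) / (of_int d * of_int c')"
    (is "?L c = ?L c'")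
  proof -
    assume cc: "real_of_int c * of_int c' = of_int q ^ 2 * of_int d ^ 2 + 1"
    have L: "?L x = - (real_of_int x + of_int y) / of_int d"
      if "real_of_int x * of_int y = of_int q ^ 2 * of_int d ^ 2 + 1" "x > 0" for x y
    proof -
      have "?L x = - (of_int x ^ 2 + (of_int q ^ 2 * of_int d ^ 2 + 1)) / (of_int d * of_int x)"
        using that(2) assms(3) by (simp add: field_simps power2_eq_square)
      also have "\<dots> = - (real_of_int x + of_int y) / of_int d"
        unfolding that(1)[symmetric] using that(2) assms(3) by (simp add: field_simps power2_eq_square)
      finally show ?thesis .
    qed
    from L[OF cc assms(1)] L[of c' c] cc assms(2) show ?thesis by (simp add: mult.commute add.commute)
  qed
  then show ?thesis unfolding r by simp
qed

lemma rademacher_values_swap: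
  assumes "c > 0" "c' > 0" "c * c' = q\<^sup>2 * d\<^sup>2 + 1"
  shows "of_int ((1 - q\<^sup>2) * d) / of_int c - dsum d c = of_int ((1 - q\<^sup>2) * d) / of_int c' - dsum d c'"
proof -
  consider "d > 0" | "d = 0" | "- d > 0" by linarith
  then show ?thesis
  proof cases
    case 1
    then show ?thesis using rademacher_values_swap_pos assms by blast
  next
    case 2
    then have "c = 1" "c' = 1" using assms by (auto simp: zmult_eq_1_iff)
    then show ?thesis by simp
  next
    case 3
    have co: "coprime d c" "coprime d c'"
      using coprime_of_dvd_square(2)[of c q d] coprime_of_dvd_square(2)[of c' q d] assms(3)
      by (metis dvd_triv_left dvd_triv_right)+
    have "c * c' = q\<^sup>2 * (- d)\<^sup>2 + 1" using assms(3) by simp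
    from rademacher_values_swap_pos[OF assms(1,2) 3 this] show ?thesis
      using dsum_uminus[OF co(1) assms(1)] dsum_uminus[OF co(2) assms(2)] by simp
  qed
qed

text \<open>The congruences modulo 4 and 8 require an odd modulus. Since 4 never divides
  \<open>q\<^sup>2 * d\<^sup>2 + 1\<close>, one of two complementary divisors is odd, and swapping
  them keeps the value.\<close>

lemma rademacher_values_odd:
  assumes "p \<in> rademacher_values q"
  obtains c d where "c > 0" "odd c" "c dvd q\<^sup>2 * d\<^sup>2 + 1" "c * p = (1 - q\<^sup>2) * d - dnum d c"
proof -
  obtain c d where cd: "c > 0" "c dvd q\<^sup>2 * d\<^sup>2 + 1"
    "of_int p = of_int ((1 - q\<^sup>2) * d) / of_int c - dsum d c"
    using assms rademacher_values_iff by blast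
  show ?thesis
  proof (cases "odd c")
    case True
    then show ?thesis using that rademacher_values_dnum cd by blast
  next
    case False
    obtain c' where c': "q\<^sup>2 * d\<^sup>2 + 1 = c * c'" using cd(2) by blast
    have "0 < c * c'" unfolding c'[symmetric] by (simp add: add_nonneg_pos)
    then have "c' > 0" using cd(1) by (simp add: zero_less_mult_iff)
    have "odd c'"
    proof
      assume "even c'"
      then have "4 dvd q\<^sup>2 * d\<^sup>2 + 1" unfolding c' using False by (auto elim!: evenE)
      moreover have "odd (q * d)" using c' False by (metis even_add even_mult_iff odd_one even_power power2_eq_square)
      then have "8 dvd (q * d)\<^sup>2 - 1" by (rule eight_dvd_square_minus_1)
      then have "4 dvd q\<^sup>2 * d\<^sup>2 - 1" by (auto simp: power_mult_distrib)
      ultimately have "4 dvd (q\<^sup>2 * d\<^sup>2 + 1) - (q\<^sup>2 * d\<^sup>2 - 1)" by (rule dvd_diff)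
      then show False by simp
    qed
    moreover have "c' dvd q\<^sup>2 * d\<^sup>2 + 1" unfolding c' by simp
    moreover have "of_int p = of_int ((1 - q\<^sup>2) * d) / of_int c' - dsum d c'"
      using cd(3) rademacher_values_swap[OF cd(1) \<open>c' > 0\<close> c'[symmetric]] by simp
    ultimately show ?thesis using that \<open>c' > 0\<close> rademacher_values_dnum by blast
  qed
qed

text \<open>For the powers of 2, \<open>dnum d c\<close> is compared with
  \<open>dnum (q * d) c\<close>, which is 0: the two agree modulo 4, and modulo 8 if
  \<open>q\<close> is a square. The divisors of \<open>q\<^sup>2 - 1\<close> carry this, and
  divisibility by 3, over to \<open>p\<close>.\<close>

lemma rademacher_values_admissible:
  assumes "p \<in> rademacher_values q"
  shows "admissible q p"
proof -
  obtain c d where cd: "c > 0" "odd c" "c dvd q\<^sup>2 * d\<^sup>2 + 1" "c * p = (1 - q\<^sup>2) * d - dnum d c"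
    using rademacher_values_odd[OF assms] .
  note co = coprime_of_dvd_square[OF cd(3)]
  have c2: "c dvd (q * d)\<^sup>2 + 1" using cd(3) by (simp add: power_mult_distrib)
  have "3 dvd p" if "\<not> 3 dvd q"
  proof -
    \<comment> \<open>This holds because -1 is not a square modulo 3.\<close>
    have "\<not> 3 dvd c"
    proof
      assume "3 dvd c"
      then have "3 dvd (q * d)\<^sup>2 + 1" using c2 dvd_trans by blast
      moreover have "\<not> 3 dvd q * d"
      proof
        assume "3 dvd q * d"
        then have "3 dvd (q * d)\<^sup>2" by (simp add: power2_eq_square)
        then have "3 dvd ((q * d)\<^sup>2 + 1) - (q * d)\<^sup>2" using calculation dvd_diff by blast
        then show False by simp
      qed
      then have "3 dvd (q * d)\<^sup>2 - 1" by (rule three_dvd_square_minus_1)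
      ultimately have "3 dvd ((q * d)\<^sup>2 + 1) - ((q * d)\<^sup>2 - 1)" by (rule dvd_diff)
      then show False by simp
    qed
    moreover from this have "3 dvd dnum d c" by (rule three_dvd_dnum[OF co(2) cd(1)])
    then have "3 dvd c * p"
      unfolding cd(4) using three_dvd_square_minus_1[OF that]
      by (metis dvd_diff dvd_mult2 dvd_minus_iff minus_diff_eq)
    moreover have "prime (3 :: int)" by simp
    ultimately show "3 dvd p" using prime_dvd_multD by blast
  qed
  moreover have dvd_p: "n dvd p" if "odd q" "n dvd dnum d c" "n dvd 8" for n
  proof -
    have "n dvd q\<^sup>2 - 1" using that eight_dvd_square_minus_1 dvd_trans by blast
    then have "n dvd c * p" unfolding cd(4) using that(2) by (metis dvd_diff dvd_mult2 dvd_minus_iff minus_diff_eq)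
    moreover have "coprime c 8" using cd(2) coprime_power_right_iff[of c 2 3] by simp
    then have "coprime n c" using that(3) coprime_divisors[of n 8 c c] by (simp add: coprime_commute)
    ultimately show ?thesis by (simp add: coprime_dvd_mult_right_iff)
  qed
  moreover have "4 dvd dnum d c"
  proof -
    have "[0 = c - 1] (mod 4)"
      using dnum_odd_mod_4[OF cd(2,1) co(3)] unfolding dnum_eq_0[OF cd(1) c2] .
    moreover have "[dnum d c = c - 1] (mod 4)" by (rule dnum_odd_mod_4[OF cd(2,1) co(2)])
    ultimately show ?thesis by (metis cong_0_iff cong_sym cong_trans)
  qed
  moreover have "8 dvd dnum d c" if sq: "is_square q"
  proof -
    obtain s where s: "q = s\<^sup>2" using sq by (auto simp: is_nth_power_def)
    have "coprime s c" using co(1) by (simp add: s)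
    from dnum_mult_square_mod_8[OF cd(2,1) co(2) this]
    have "[dnum (q * d) c = dnum d c] (mod 8)" by (simp add: s mult.commute)
    then show ?thesis unfolding dnum_eq_0[OF cd(1) c2] by (metis cong_0_iff cong_sym)
  qed
  ultimately show ?thesis unfolding admissible_def by simp
qed

section \<open>Explicit witnesses and the bound from below\<close>

definition dnum_list :: "int \<Rightarrow> int \<Rightarrow> int" where
  "dnum_list a b = 2 * a * (b - 1) * (2 * b - 1)
     - 12 * sum_list (map (\<lambda>k. k * (a * k div b)) [1..b - 1]) - 3 * b * (b - 1)"

lemma dnum_eq_dnum_list: "dnum a b = dnum_list a b"
proof -
  have "{1..b - 1} = {1..<b}" by auto
  then show ?thesis by (simp add: dnum_def dnum_list_def interv_sum_list_conv_sum_set_int)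
qed

text \<open>Both arguments of the second gcd are periods, so such an \<open>e\<close> makes 24 a
  period.\<close>

definition period_witness :: "int \<Rightarrow> int \<Rightarrow> bool" where
  "period_witness q e \<longleftrightarrow> e > 0 \<and> gcd e q = 1
     \<and> gcd ((e - 1) * (e - 2) - dnum_list (q\<^sup>2) e) (q\<^sup>2 - 1) dvd 24"

text \<open>The moduli in the next table and the pairs in the table after it were found by search.\<close>

lemma period_table:
  "list_all (\<lambda>q. list_ex (period_witness q) [5, 7, 9, 11, 13, 16, 23, 43, 53, 59, 1]) [2..200]"
  by code_simp

lemma period_witness_exists:
  assumes "2 \<le> q" "q \<le> 200"
  shows "\<exists>e. period_witness q e"
proof -
  have "q \<in> set [2..200]" using assms by (simp only: set_upto atLeastAtMost_iff)
  with period_table have "list_ex (period_witness q) [5, 7, 9, 11, 13, 16, 23, 43, 53, 59, 1]"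
    by (rule list_all_iff[THEN iffD1, THEN bspec])
  then show ?thesis unfolding list_ex_iff by (rule bexE) (rule exI)
qed


text \<open>For odd \<open>q\<close>, 8 divides \<open>q\<^sup>2 - 1\<close>, so the value
  \<open>p\<close> at a witness has \<open>c * p\<close> congruent to \<open>- dnum d c\<close>,
  hence \<open>p\<close> is 4 modulo 8.\<close>

definition nonresidue_witness :: "int \<Rightarrow> int \<times> int \<Rightarrow> bool" where
  "nonresidue_witness q = (\<lambda>(c, d). c dvd q\<^sup>2 * d\<^sup>2 + 1 \<and> c > 0 \<and> odd c \<and> dnum_list d c mod 8 = 4)"

lemma nonresidue_table:
  "list_all (\<lambda>q. even q \<or> list_ex (\<lambda>s. s\<^sup>2 = q) [3, 5, 7, 9, 11, 13]
     \<or> list_ex (nonresidue_witness q) [(5, 1), (13, 1), (13, 3), (13, 4), (17, 3), (17, 5), (17, 6), (17, 7),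
       (29, 1), (29, 4), (29, 5), (29, 6), (29, 7), (29, 9), (29, 13), (37, 1), (37, 3), (37, 11)]) [2..200]"
  by code_simp

lemma nonresidue_witness_exists:
  assumes "2 \<le> q" "q \<le> 200" "odd q" "\<not> is_square q"
  shows "\<exists>x. nonresidue_witness q x"
proof -
  have q: "q \<in> set [2..200]" using assms by (simp only: set_upto atLeastAtMost_iff)
  have "\<not> list_ex (\<lambda>s. s\<^sup>2 = q) xs" for xs
    using assms(4) by (auto simp: list_ex_iff is_nth_power_def)
  then show ?thesis
    using bspec[OF iffD1[OF list_all_iff nonresidue_table] q] assms(3)
    unfolding list_ex_iff by (elim disjE bexE) (blast+)
qed

text \<open>If 3 divides \<open>q\<close> then it does not divide \<open>q\<^sup>2 - 1\<close>, and
  if \<open>q\<close> is even then \<open>q\<^sup>2 - 1\<close> is odd; so each factor of the gcd is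
  trivial or divides \<open>n\<close> by hypothesis.\<close>

lemma gcd_square_minus_1_dvd:
  fixes q n N :: int
  assumes "\<not> 3 dvd q \<Longrightarrow> 3 dvd n" "odd q \<Longrightarrow> N dvd n" "N dvd 8"
  shows "gcd (3 * N) (q\<^sup>2 - 1) dvd n"
proof -
  define g where "g = gcd (3 * N) (q\<^sup>2 - 1)"
  have g: "g dvd 3 * N" "g dvd q\<^sup>2 - 1" by (simp_all add: g_def)
  obtain u v where uv: "g = u * v" "u dvd 3" "v dvd N" using division_decomp[OF g(1)] by blast
  have uv': "u dvd q\<^sup>2 - 1" "v dvd q\<^sup>2 - 1" using g(2) uv(1) dvd_mult_left dvd_mult_right by blast+
  have c3: "coprime (3 :: int) 8" using coprime_power_right_iff[of "3 :: int" 2 3] by simp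
  have "u dvd n"
  proof (cases "3 dvd q")
    case True
    then have "u dvd q\<^sup>2" using uv(2) by (metis dvd_mult dvd_trans power2_eq_square)
    then have "u dvd q\<^sup>2 - (q\<^sup>2 - 1)" using uv'(1) dvd_diff by blast
    then have "u dvd 1" by simp
    then show ?thesis by (rule dvd_trans) simp
  qed (use assms(1) uv(2) dvd_trans in blast)
  moreover have "v dvd n"
  proof (cases "odd q")
    case False
    then have "odd (q\<^sup>2 - 1)" by simp
    then have "odd v" using uv'(2) dvd_trans by blast
    then have "coprime v 8" using coprime_power_right_iff[of v 2 3] by simp
    moreover have "v dvd 8" using uv(3) assms(3) dvd_trans by blast
    ultimately have "v dvd 1" using coprime_common_divisor[of v 8 v] by simp
    then show ?thesis by (rule dvd_trans) simp
  qed (use assms(2) uv(3) dvd_trans in blast)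
  moreover have "coprime u v"
    using c3 uv(2,3) assms(3) coprime_divisors dvd_trans by blast
  ultimately have "u * v dvd n" by (rule divides_mult)
  then show ?thesis using uv(1) g_def by simp
qed

lemma rademacher_values_eq:
  assumes "2 \<le> q" "q \<le> 200"
  shows "rademacher_values q = {p. admissible q p}"
proof
  show "rademacher_values q \<subseteq> {p. admissible q p}" using rademacher_values_admissible by blast
  obtain e where e: "e > 0" "coprime e q" "gcd ((e - 1) * (e - 2) - dnum (q\<^sup>2) e) (q\<^sup>2 - 1) dvd 24"
    using period_witness_exists[OF assms]
    by (auto simp: period_witness_def dnum_eq_dnum_list coprime_iff_gcd_eq_1)
  then have "(e - 1) * (e - 2) - dnum (q\<^sup>2) e \<in> periods (rademacher_values q)"
    using reciprocity_period[OF _ e(1,2)] assms(1) by simp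
  then have "24 \<in> periods (rademacher_values q)"
    using periods_gcd square_minus_1_period periods_dvd e(3) by blast
  then have per: "gcd (3 * 8) (q\<^sup>2 - 1) \<in> periods (rademacher_values q)"
    using periods_gcd square_minus_1_period by simp
  have shift: "p + n \<in> rademacher_values q"
    if "p \<in> rademacher_values q" "\<not> 3 dvd q \<Longrightarrow> 3 dvd n" "odd q \<Longrightarrow> 8 dvd n" for p n
    using periods_dvd[OF per gcd_square_minus_1_dvd[of q n 8]] that unfolding periods_def by simp
  show "{p. admissible q p} \<subseteq> rademacher_values q"
  proof
    fix n assume "n \<in> {p. admissible q p}"
    then have n: "\<not> 3 dvd q \<Longrightarrow> 3 dvd n" "odd q \<Longrightarrow> 4 dvd n" "odd q \<Longrightarrow> is_square q \<Longrightarrow> 8 dvd n"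
      by (auto simp: admissible_def)
    show "n \<in> rademacher_values q"
    proof (cases "odd q \<and> \<not> 8 dvd n")
      case False
      then have "0 + n \<in> rademacher_values q" by (intro shift zero_in_rad_values n(1)) simp_all
      then show ?thesis by simp
    next
      case True
      \<comment> \<open>Here \<open>n\<close> is 4 modulo 8. The witness gives a value
        \<open>p\<close> that is also 4 modulo 8, so \<open>n - p\<close> is a period.\<close>
      then obtain c d where cd: "c dvd q\<^sup>2 * d\<^sup>2 + 1" and c: "c > 0" "odd c" "dnum d c mod 8 = 4"
        using nonresidue_witness_exists[OF assms] n(3)
        by (auto simp: nonresidue_witness_def dnum_eq_dnum_list)
      from rademacher_values_exists[OF c(1) cd] obtain p
        where p: "p \<in> rademacher_values q" "c * p = (1 - q\<^sup>2) * d - dnum d c" by metis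
      have "\<not> 8 dvd p"
      proof
        assume "8 dvd p"
        then have "8 dvd c * p + (q\<^sup>2 - 1) * d"
          using True eight_dvd_square_minus_1[of q] by simp
        also have "c * p + (q\<^sup>2 - 1) * d = - dnum d c" unfolding p(2) by (simp add: algebra_simps)
        finally show False using c(3) by auto
      qed
      moreover have "4 dvd p" "4 dvd n" "\<not> 3 dvd q \<Longrightarrow> 3 dvd p"
        using rademacher_values_admissible[OF p(1)] n(2) True by (auto simp: admissible_def)
      ultimately have "8 dvd n - p" using True by presburger
      moreover have "\<not> 3 dvd q \<Longrightarrow> 3 dvd n - p" using n(1) \<open>\<not> 3 dvd q \<Longrightarrow> 3 dvd p\<close> dvd_diff by blast
      ultimately have "p + (n - p) \<in> rademacher_values q" using shift[OF p(1)] by blast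
      then show ?thesis by simp
    qed
  qed
qed

section \<open>The two sets of residues\<close>

lemma dsum_square_mult:
  assumes "c > 0" "c dvd q\<^sup>2 * d\<^sup>2 + 1"
  shows "dsum (q\<^sup>2 * d) c = - dsum d c"
proof -
  have "q\<^sup>2 * d * (- d) - 1 = - (q\<^sup>2 * d\<^sup>2 + 1)" by (simp add: power2_eq_square)
  then have "[q\<^sup>2 * d * (- d) = 1] (mod c)" using assms(2) by (metis cong_iff_dvd_diff dvd_minus_iff)
  then have "dsum (q\<^sup>2 * d) c = dsum (- d) c" by (rule dsum_inverse[OF assms(1)])
  then show ?thesis using dsum_uminus coprime_of_dvd_square(2) assms by metis
qed

text \<open>Dividing \<open>a\<close> by \<open>q\<close> modulo \<open>t\<close> replaces it by
  \<open>q * \<alpha>\<close>. The error is a multiple of \<open>t\<close> and changes the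
  expression by a multiple of \<open>q\<^sup>2 - 1\<close>; at \<open>q * \<alpha>\<close> the
  expression is \<open>- q\<close> times a value of \<Phi>.\<close>

lemma Lambda_set_eq: "Lambda_set q = {(- q * p) mod (q\<^sup>2 - 1) | p. p \<in> rademacher_values q}"
proof (intro equalityI subsetI)
  fix x assume "x \<in> Lambda_set q"
  then obtain n a t where x: "x = n mod (q\<^sup>2 - 1)" "t > 0" "t dvd a\<^sup>2 + 1" "coprime (a * q) t"
    "of_int n = of_int ((q\<^sup>2 - 1) * a) / of_int t - of_int q * dsum (a * q) t"
    unfolding Lambda_set_def by blast
  have "coprime q t" using x(4) by simp
  then obtain r where r: "[q * r = 1] (mod t)" using cong_solve_coprime_int by blast
  define \<alpha> where "\<alpha> = r * a"
  have q\<alpha>: "[q * \<alpha> = a] (mod t)" using cong_scalar_right[OF r, of a] by (simp add: \<alpha>_def mult.assoc)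
  then obtain m where m: "q * \<alpha> = a + t * m"
    by (metis cong_iff_dvd_diff dvdE diff_eq_eq add.commute)
  have "q\<^sup>2 * \<alpha>\<^sup>2 + 1 = (a\<^sup>2 + 1) + t * (m * (2 * a + t * m))"
    unfolding power_mult_distrib[symmetric] m by (simp add: algebra_simps power2_eq_square)
  then have dvd: "t dvd q\<^sup>2 * \<alpha>\<^sup>2 + 1" using x(3) by (metis dvd_add dvd_triv_left)
  obtain p where p: "p \<in> rademacher_values q" "of_int p = of_int ((1 - q\<^sup>2) * \<alpha>) / of_int t - dsum \<alpha> t"
    using rademacher_values_exists[OF x(2) dvd] by metis
  have "[a * q = q\<^sup>2 * \<alpha>] (mod t)"
    using cong_scalar_left[OF cong_sym[OF q\<alpha>], of q] by (simp add: power2_eq_square algebra_simps)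
  then have eq: "dsum (a * q) t = - dsum \<alpha> t"
    using dsum_cong[OF x(4,2)] dsum_square_mult[OF x(2) dvd] by simp
  have a: "real_of_int a = of_int q * of_int \<alpha> - of_int t * of_int m"
    using arg_cong[OF m, of real_of_int] by simp
  have "real_of_int n = of_int (- q * p - (q\<^sup>2 - 1) * m)"
    unfolding x(5) of_int_diff of_int_mult of_int_minus p(2) eq a using x(2) by (simp add: field_simps)
  then have "n = - q * p - (q\<^sup>2 - 1) * m" by linarith
  then have "n mod (q\<^sup>2 - 1) = (- q * p) mod (q\<^sup>2 - 1)"
    by (simp add: mod_eq_dvd_iff)
  then show "x \<in> {(- q * p) mod (q\<^sup>2 - 1) | p. p \<in> rademacher_values q}" using x(1) p(1) by blast
next
  fix x assume "x \<in> {(- q * p) mod (q\<^sup>2 - 1) | p. p \<in> rademacher_values q}"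
  then obtain p where p: "x = (- q * p) mod (q\<^sup>2 - 1)" "p \<in> rademacher_values q" by blast
  then obtain c d where cd: "c > 0" "c dvd q\<^sup>2 * d\<^sup>2 + 1"
    "of_int p = of_int ((1 - q\<^sup>2) * d) / of_int c - dsum d c"
    unfolding rademacher_values_iff by blast
  have "dsum (q * d * q) c = - dsum d c"
    using dsum_square_mult[OF cd(1,2)] by (simp add: power2_eq_square mult.commute mult.left_commute)
  then have "of_int (- q * p) = of_int ((q\<^sup>2 - 1) * (q * d)) / of_int c - of_int q * dsum (q * d * q) c"
    using cd(1) unfolding of_int_mult of_int_minus cd(3) by (simp add: field_simps)
  moreover have "c dvd (q * d)\<^sup>2 + 1" using cd(2) by (simp add: power_mult_distrib)
  moreover have "coprime (q * d * q) c" using coprime_of_dvd_square[OF cd(2)] by simp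
  ultimately show "x \<in> Lambda_set q" unfolding Lambda_set_def p(1) using cd(1) by blast
qed

text \<open>By Bezout, multiples of the gcd are multiples of \<open>N\<close> modulo
  \<open>m\<close>. Since \<open>q\<close> is its own inverse modulo \<open>m\<close>, a second
  factor \<open>- q\<close> undoes the first.\<close>

lemma multiples_mod_eq:
  fixes m N q :: int
  assumes "m > 0" "[q * q = 1] (mod m)"
    and "\<And>p. p \<in> P \<Longrightarrow> gcd N m dvd p" "\<And>s. N * s \<in> P"
  shows "{(- q * p) mod m | p. p \<in> P} = {(N * s) mod m | s. s \<in> carrier (residue_ring m)}"
proof (intro equalityI subsetI)
  fix x assume "x \<in> {(- q * p) mod m | p. p \<in> P}"
  then obtain p where p: "x = (- q * p) mod m" "p \<in> P" by blast
  then obtain l where l: "p = gcd N m * l" using assms(3) by blast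
  obtain u v where "u * N + v * m = gcd N m" using bezout_int by blast
  then have "- q * p = N * (- q * u * l) + m * (- q * v * l)"
    unfolding l by (simp add: algebra_simps flip: \<open>u * N + v * m = gcd N m\<close>)
  then have "x = (N * (- q * u * l)) mod m"
    unfolding p(1) by (simp only: mod_mult_self2)
  then have "x = (N * ((- q * u * l) mod m)) mod m"
    by (simp only: mod_mult_right_eq)
  moreover have "(- q * u * l) mod m \<in> carrier (residue_ring m)"
    using assms(1) by (simp add: residue_ring_def)
  ultimately show "x \<in> {(N * s) mod m | s. s \<in> carrier (residue_ring m)}" by blast
next
  fix x assume "x \<in> {(N * s) mod m | s. s \<in> carrier (residue_ring m)}"
  then obtain s where x: "x = (N * s) mod m" by blast
  have eq: "- q * (N * (- q * s)) = q * q * (N * s)" by simp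
  have "(- q * (N * (- q * s))) mod m = x"
    unfolding x eq using cong_scalar_right[OF assms(2), of "N * s"] by (simp only: cong_def mult_1)
  then show "x \<in> {(- q * p) mod m | p. p \<in> P}" using assms(4) by blast
qed

lemma Lambda_set_eq_Gamma_set:
  assumes "2 \<le> q" "q \<le> 200"
  shows "Lambda_set q = Gamma_set q"
proof -
  have "2 * 2 \<le> q * q" using assms(1) by (intro mult_mono) auto
  then have m: "q\<^sup>2 - 1 > 0" by (simp add: power2_eq_square)
  have qq: "[q * q = 1] (mod (q\<^sup>2 - 1))" by (simp add: cong_iff_dvd_diff power2_eq_square)
  show ?thesis
  proof (cases "is_square q")
    case True
    have "{(- q * p) mod (q\<^sup>2 - 1) | p. p \<in> {p. admissible q p}}
        = {(24 * s) mod (q\<^sup>2 - 1) | s. s \<in> carrier (residue_ring (q\<^sup>2 - 1))}"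
    proof (rule multiples_mod_eq[OF m qq])
      show "gcd 24 (q\<^sup>2 - 1) dvd p" if "p \<in> {p. admissible q p}" for p
        using gcd_square_minus_1_dvd[of q p 8] that True by (simp add: admissible_def)
      show "24 * s \<in> {p. admissible q p}" for s by (simp add: admissible_def)
    qed
    then show ?thesis using True
      unfolding Lambda_set_eq rademacher_values_eq[OF assms] Gamma_set_def by simp
  next
    case False
    have "{(- q * p) mod (q\<^sup>2 - 1) | p. p \<in> {p. admissible q p}}
        = {(12 * s) mod (q\<^sup>2 - 1) | s. s \<in> carrier (residue_ring (q\<^sup>2 - 1))}"
    proof (rule multiples_mod_eq[OF m qq])
      show "gcd 12 (q\<^sup>2 - 1) dvd p" if "p \<in> {p. admissible q p}" for p
        using gcd_square_minus_1_dvd[of q p 4] that by (simp add: admissible_def)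
      show "12 * s \<in> {p. admissible q p}" for s using False by (simp add: admissible_def)
    qed
    then show ?thesis using False
      unfolding Lambda_set_eq rademacher_values_eq[OF assms] Gamma_set_def by simp
  qed
qed

section \<open>Values of Dedekind sums with given denominator\<close>

text \<open>The matrix \<open>M\<close> has first column \<open>(a, b)\<close> and trace \<open>b k / q\<close>, so that \<open>\<Phi>(M) = 0\<close>. The matrices
  that bring it to the form \<open>a = - q\<^sup>2 d\<close> have rows \<open>(q j, 1), (- 1, 0)\<close> on the left and
  \<open>(- k, w), (q, j)\<close> on the right.\<close>

lemma dsum_value_imp_rademacher_value:
  assumes "q > 0" "coprime k q" "(- k) * j - w * q = 1"
    and ab: "b \<ge> 1" "coprime a b" "dsum a b = of_int k / of_int q"
  shows "\<exists>p\<in>rademacher_values q. of_int p = rademacher (- k) w q j - of_int (q * j)"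
proof -
  have b: "b > 0" using ab(1) by simp
  have "real_of_int (q * dnum a b) = of_int (b * k)"
    using dsum_eq_dnum[OF ab(2) b] ab(3) assms(1) by (simp add: field_simps)
  then have qN: "q * dnum a b = b * k" by linarith
  then have "q dvd b" using assms(2) by (metis coprime_commute coprime_dvd_mult_left_iff dvd_triv_left)
  then obtain t where t: "b = q * t" by blast
  have "t > 0" using b assms(1) t by (simp add: zero_less_mult_iff)
  have N: "dnum a b = t * k" using qN assms(1) t by simp
  have "b dvd a * (t * k) - (a\<^sup>2 + 1)"
    using dnum_mult_cong[OF ab(2) b] N by (simp add: cong_iff_dvd_diff)
  then obtain y where y: "a * (t * k) - (a\<^sup>2 + 1) = b * y" by blast
  \<comment> \<open>This completes the column \<open>(a, b)\<close> to a unimodular matrix with rows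
    \<open>(a, y)\<close> and \<open>(b, z)\<close> and the required trace.\<close>
  define z where "z = t * k - a"
  have det: "a * z - y * b = 1" using y by (simp add: z_def algebra_simps power2_eq_square)
  have "[a * z = 1] (mod b)" using det by (simp add: cong_iff_dvd_diff) (metis diff_eq_eq dvd_triv_right add_diff_cancel_left')
  then have "dsum z b = dsum a b" using dsum_inverse[OF b] by metis
  then have "rademacher a y b z = of_int (a + z) / of_int b - of_int k / of_int q"
    using b ab(3) by (simp add: rademacher_def)
  then have rad0: "rademacher a y b z = 0"
    using assms(1) \<open>t > 0\<close> by (simp add: z_def t)
  define u where "u = q * j"
  have detB: "u * 0 - 1 * (-1) = 1" by simp
  have radB: "rademacher u 1 (-1) 0 = - of_int (q * j)" by (simp add: rademacher_def u_def)
  define a1 where "a1 = u * a + 1 * b"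
  define b1 where "b1 = u * y + 1 * z"
  define c1 where "c1 = (-1) * a + 0 * b"
  define d1 where "d1 = (-1) * y + 0 * z"
  have 1: "rademacher a1 b1 c1 d1 = rademacher u 1 (-1) 0 + rademacher a y b z - 3 * of_int (sgn ((-1) * b * c1))"
    unfolding a1_def b1_def c1_def d1_def by (rule rademacher_mult[OF detB det])
  have det1: "a1 * d1 - b1 * c1 = 1"
    using det by (simp add: a1_def b1_def c1_def d1_def algebra_simps)
  define b2 where "b2 = a1 * w + b1 * j"
  define c2 where "c2 = c1 * (- k) + d1 * q"
  define d2 where "d2 = c1 * w + d1 * j"
  have 2: "rademacher (a1 * (- k) + b1 * q) b2 c2 d2
      = rademacher a1 b1 c1 d1 + rademacher (- k) w q j - 3 * of_int (sgn (c1 * q * c2))"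
    unfolding b2_def c2_def d2_def by (rule rademacher_mult[OF det1 assms(3)])
  have a2: "a1 * (- k) + b1 * q = - q\<^sup>2 * d2"
  proof -
    \<comment> \<open>The determinant turns the first term into \<open>a\<close>, and the trace
      cancels \<open>a + z - t * k\<close>; the rest has the factor
      \<open>q\<^sup>2\<close>.\<close>
    have "a1 * (- k) + b1 * q = q * (((- k) * j - w * q) * a + q * (w * a + y * j) + (z - t * k))"
      by (simp add: a1_def b1_def u_def t algebra_simps power2_eq_square)
    also have "\<dots> = q\<^sup>2 * (w * a + y * j)" using assms(3) by (simp add: z_def power2_eq_square)
    finally show ?thesis by (simp add: d2_def c1_def d1_def algebra_simps)
  qed
  have det2: "(- q\<^sup>2 * d2) * d2 - b2 * c2 = 1"
  proof -
    have "(a1 * (- k) + b1 * q) * d2 - b2 * c2 = (a1 * d1 - b1 * c1) * ((- k) * j - w * q)"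
      unfolding b2_def c2_def d2_def by (simp add: algebra_simps)
    then show ?thesis using det1 assms(3) a2 by simp
  qed
  \<comment> \<open>This makes \<open>c2\<close> positive, so the sign terms of the two products are
    opposite.\<close>
  have "t * c2 = a\<^sup>2 + 1" using y by (simp add: c2_def c1_def d1_def t algebra_simps)
  then have "t * c2 > 0" by (simp add: add_nonneg_pos)
  then have c2: "c2 > 0" using \<open>t > 0\<close> by (simp add: zero_less_mult_iff)
  have "sgn ((-1) * b * c1) = - sgn c1" "sgn (c1 * q * c2) = sgn c1"
    using b c2 assms(1) by (simp_all add: sgn_mult)
  then have radN: "rademacher (- q\<^sup>2 * d2) b2 c2 d2 = rademacher (- k) w q j - of_int (q * j)"
    using 1 2 unfolding a2 radB rad0 by simp
  moreover obtain p where "rademacher (- q\<^sup>2 * d2) b2 c2 d2 = of_int p"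
    using rademacher_in_Ints[OF det2 c2] by (auto elim: Ints_cases)
  ultimately show ?thesis unfolding rademacher_values_def using det2 c2 by (metis (mono_tags, lifting) mem_Collect_eq)
qed

text \<open>The preceding construction reversed, with the inverses of the two fixed matrices: the
  result has lower left entry \<open>q * t\<close>, trace \<open>t * k\<close> and \<Phi> equal to
  0.\<close>

lemma rademacher_value_imp_dsum_value:
  assumes "q > 0" "(- k) * j - w * q = 1"
    and p: "p \<in> rademacher_values q" "of_int p = rademacher (- k) w q j - of_int (q * j)"
  shows "\<exists>a b. b \<ge> 1 \<and> coprime a b \<and> dsum a b = of_int k / of_int q"
proof -
  obtain b c d where M: "c > 0" "(- q\<^sup>2 * d) * d - b * c = 1" "of_int p = rademacher (- q\<^sup>2 * d) b c d"
    using p(1) unfolding rademacher_values_def by auto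
  define u where "u = q * j"
  have detB: "0 * u - (-1) * 1 = 1" by simp
  have radB: "rademacher 0 (-1) 1 u = of_int (q * j)" by (simp add: rademacher_def u_def)
  have detA: "j * (- k) - (- w) * (- q) = 1" using assms(2) by (simp add: algebra_simps)
  define a1 where "a1 = 0 * (- q\<^sup>2 * d) + (-1) * c"
  define b1 where "b1 = 0 * b + (-1) * d"
  define c1 where "c1 = 1 * (- q\<^sup>2 * d) + u * c"
  define d1 where "d1 = 1 * b + u * d"
  have 1: "rademacher a1 b1 c1 d1 = rademacher 0 (-1) 1 u + rademacher (- q\<^sup>2 * d) b c d - 3 * of_int (sgn (1 * c * c1))"
    unfolding a1_def b1_def c1_def d1_def by (rule rademacher_mult[OF detB M(2)])
  have det1: "a1 * d1 - b1 * c1 = 1"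
    using M(2) by (simp add: a1_def b1_def c1_def d1_def algebra_simps)
  define x where "x = a1 * j + b1 * (- q)"
  define y where "y = a1 * (- w) + b1 * (- k)"
  define e where "e = c1 * j + d1 * (- q)"
  define z where "z = c1 * (- w) + d1 * (- k)"
  have 2: "rademacher x y e z = rademacher a1 b1 c1 d1 + rademacher j (- w) (- q) (- k) - 3 * of_int (sgn (c1 * (- q) * e))"
    unfolding x_def y_def e_def z_def by (rule rademacher_mult[OF det1 detA])
  have det2: "x * z - y * e = 1"
  proof -
    have "x * z - y * e = (a1 * d1 - b1 * c1) * (j * (- k) - (- w) * (- q))"
      unfolding x_def y_def e_def z_def by (simp add: algebra_simps)
    then show ?thesis using det1 detA by simp
  qed
  define t where "t = j\<^sup>2 * c - 2 * q * j * d - b"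
  have e: "e = q * t" by (simp add: e_def c1_def d1_def t_def u_def algebra_simps power2_eq_square)
  \<comment> \<open>Completing the square leaves the determinant 1 as remainder, so \<open>t\<close>
    is positive.\<close>
  have "c * t = (j * c - q * d)\<^sup>2 + ((- q\<^sup>2 * d) * d - b * c)"
    by (simp add: t_def algebra_simps power2_eq_square)
  then have "c * t > 0" unfolding M(2) by (simp add: add_nonneg_pos)
  then have t: "t > 0" using M(1) by (simp add: zero_less_mult_iff)
  then have e_pos: "e > 0" using e assms(1) by simp
  have "sgn (1 * c * c1) = sgn c1" "sgn (c1 * (- q) * e) = - sgn c1"
    using M(1) e_pos assms(1) by (simp_all add: sgn_mult sgn_minus)
  then have "rademacher x y e z = 0"
    using 1 2 rademacher_inverse[OF assms(2)] M(3) p(2) radB by simp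
  then have z: "dsum z e = of_int (x + z) / of_int e" using e_pos by (simp add: rademacher_def)
  have "x + z = t * k"
  proof -
    have "x + z - t * k = (j * c - q * d) * ((- k) * j - w * q - 1)"
      by (simp add: x_def z_def t_def a1_def b1_def c1_def d1_def u_def algebra_simps power2_eq_square)
    then show ?thesis using assms(2) by simp
  qed
  then have "dsum z e = of_int k / of_int q"
    using z t unfolding e by simp
  moreover have "coprime z e" using unimodular_coprime[OF det2] by simp
  ultimately show ?thesis using e_pos by (metis zless_imp_add1_zle add_0)
qed

text \<open>Reciprocity makes the square \<open>q\<close> the first argument, where it acts like 1
  modulo 8. This requires an odd modulus, so \<open>k\<close> is first replaced by an odd positive
  representative. The rest is explicit, as \<open>q\<close> and \<open>k'\<^sup>2\<close> are 1
  modulo 8.\<close>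

lemma eight_dvd_dnum_square:
  assumes "odd q" "q > 0" "is_square q" "coprime k q"
  shows "8 dvd dnum k q"
proof -
  obtain s where s: "q = s\<^sup>2" using assms(3) by (auto simp: is_nth_power_def)
  obtain k' where k': "k' > 0" "odd k'" "[k = k'] (mod q)"
  proof
    define n where "n = 2 * \<bar>k\<bar> + (if even k then 1 else 0)"
    have "n \<ge> \<bar>k\<bar>" "n > 0" by (auto simp: n_def)
    then have "q * n \<ge> n" using assms(2) by (simp add: mult_le_cancel_right1)
    moreover have "n > \<bar>k\<bar>" unfolding n_def by auto
    ultimately show "k + q * n > 0" by linarith
    show "odd (k + q * n)" using assms(1) by (auto simp: n_def)
  qed (simp add: cong_iff_dvd_diff)
  have co: "coprime k' q" using assms(4) k'(3) cong_imp_coprime by blast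
  then have "coprime 1 k'" "coprime s k'" by (simp_all add: s coprime_commute)
  from dnum_mult_square_mod_8[OF k'(2,1) this]
  have "8 dvd dnum q k' - dnum 1 k'" by (simp add: s cong_iff_dvd_diff)
  moreover have "dnum 1 k' = k'\<^sup>2 + 2 - 3 * k'"
    using dnum_reciprocity[of 1 k'] k'(1) by (simp add: dnum_def[of k' 1])
  ultimately obtain A where A: "dnum q k' = k'\<^sup>2 + 2 - 3 * k' + 8 * A"
    by (metis diff_eq_eq dvdE add.commute)
  obtain B where B: "q = 1 + 8 * B"
    using eight_dvd_square_minus_1[of s] assms(1) s by (metis diff_eq_eq dvdE add.commute even_power zero_less_numeral)
  obtain C where C: "k'\<^sup>2 = 1 + 8 * C"
    using eight_dvd_square_minus_1[OF k'(2)] by (metis diff_eq_eq dvdE add.commute)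
  have "k' * dnum k' q = k'\<^sup>2 + q\<^sup>2 + 1 - 3 * k' * q - q * dnum q k'"
    using dnum_reciprocity[OF co k'(1) assms(2)] by simp
  also have "\<dots> = 8 * (C - q * (C + A) + B * (q - 2))"
    unfolding A C by (simp add: B algebra_simps power2_eq_square)
  finally have "8 dvd k' * dnum k' q" by simp
  moreover have "coprime 8 k'" using k'(2) coprime_power_right_iff[of k' 2 3] by (simp add: coprime_commute)
  ultimately have "8 dvd dnum k' q" by (simp add: coprime_dvd_mult_right_iff)
  then show ?thesis using dnum_cong[OF assms(4,2) k'(3)] by simp
qed

section \<open>Admissibility in terms of the numerator\<close>

lemma admissible_mult_iff: "admissible q (q * p) \<longleftrightarrow> admissible q p"
proof -
  have "3 dvd q * p \<longleftrightarrow> 3 dvd p" if "\<not> 3 dvd q"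
    using that by (simp add: prime_dvd_mult_iff)
  moreover have "coprime 4 q" "coprime 8 q" if "odd q"
    using that coprime_power_right_iff[of q 2 3] coprime_power_right_iff[of q 2 2]
    by (simp_all add: coprime_commute)
  ultimately show ?thesis unfolding admissible_def by (auto simp: coprime_dvd_mult_right_iff)
qed

lemma admissible_add_iff: "admissible q (x - (q\<^sup>2 - 1) * y) \<longleftrightarrow> admissible q x"
proof -
  have "n dvd x - (q\<^sup>2 - 1) * y \<longleftrightarrow> n dvd x" if "n dvd q\<^sup>2 - 1" for n
    using that by (simp add: dvd_diff_left_iff)
  moreover have "4 dvd q\<^sup>2 - 1" if "odd q"
    using eight_dvd_square_minus_1[OF that] by (rule dvd_trans[rotated]) simp
  ultimately show ?thesis
    unfolding admissible_def using three_dvd_square_minus_1 eight_dvd_square_minus_1 by blast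
qed

text \<open>For odd \<open>q\<close>, \<open>dnum k q\<close> is \<open>q - 1\<close> modulo 4,
  which gives the split on \<open>q\<close> modulo 4. For odd squares it is 0 modulo 8, and these
  are 1 modulo 8, so the first branch cannot occur.\<close>

lemma admissible_dnum_iff:
  assumes "q > 0" "coprime k q"
  shows "admissible q (dnum k q - k) \<longleftrightarrow>
    (\<not> 3 dvd q \<longrightarrow> 3 dvd k) \<and>
    (\<not> 2 dvd q \<longrightarrow>
      (if [q = 3] (mod 4) then [k = 2] (mod 4)
       else if is_square q then [k = 0] (mod 8)
       else [k = 0] (mod 4)))"
proof -
  have 3: "3 dvd dnum k q - k \<longleftrightarrow> 3 dvd k" if "\<not> 3 dvd q"
    using three_dvd_dnum[OF assms(2,1) that] by presburger
  have 4: "4 dvd dnum k q - k \<longleftrightarrow> (if [q = 3] (mod 4) then [k = 2] (mod 4) else [k = 0] (mod 4))" if "odd q"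
  proof -
    have "4 dvd dnum k q - (q - 1)" using dnum_odd_mod_4[OF that assms] by (simp add: cong_iff_dvd_diff)
    then show ?thesis using that unfolding cong_def by simp presburger
  qed
  have 8: "(4 dvd dnum k q - k \<and> 8 dvd dnum k q - k \<longleftrightarrow> [k = 0] (mod 8)) \<and> \<not> [q = 3] (mod 4)"
    if sq: "odd q" "is_square q"
  proof -
    have "8 dvd dnum k q" by (rule eight_dvd_dnum_square[OF sq(1) assms(1) sq(2) assms(2)])
    moreover obtain s where s: "q = s\<^sup>2" using sq(2) by (auto simp: is_nth_power_def)
    then have "8 dvd q - 1" using eight_dvd_square_minus_1[of s] sq(1) by simp
    ultimately show ?thesis unfolding cong_def by presburger
  qed
  show ?thesis
    unfolding admissible_def using 3 4 8 by auto
qed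

text \<open>Existence of \<open>a\<close> and \<open>b\<close> amounts to \<open>r - q * j\<close>
  being in \<open>rademacher_values q\<close>. Times \<open>q\<close>, this integer is
  \<open>dnum k q - k\<close> up to a multiple of \<open>q\<^sup>2 - 1\<close>, and neither change
  affects admissibility.\<close>

lemma dsum_values_iff:
  assumes "2 \<le> q" "q \<le> 200" "coprime k q"
  shows "(\<exists>a b. b \<ge> 1 \<and> coprime a b \<and> dsum a b = of_int k / of_int q)
    \<longleftrightarrow> admissible q (dnum k q - k)"
proof -
  have q: "q > 0" using assms(1) by simp
  obtain j' where "[k * j' = 1] (mod q)" using cong_solve_coprime_int[OF assms(3)] by blast
  then obtain w where "k * j' - 1 = q * w" by (metis cong_iff_dvd_diff dvdE)
  then have det: "(- k) * (- j') - w * q = 1" by (simp add: algebra_simps)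
  define j where "j = - j'"
  have det: "(- k) * j - w * q = 1" using det by (simp add: j_def)
  have "(- k) * j - 1 = q * w" using det by (simp add: algebra_simps)
  then have "[(- k) * j = 1] (mod q)" by (metis cong_iff_dvd_diff dvd_triv_left)
  then have "dsum j q = - dsum k q"
    using dsum_inverse[OF q] dsum_uminus[OF assms(3) q] by metis
  then have eq: "of_int q * (rademacher (- k) w q j - of_int (q * j)) = of_int (dnum k q - k - (q\<^sup>2 - 1) * j)"
    using q dsum_eq_dnum[OF assms(3) q] by (simp add: rademacher_def field_simps power2_eq_square)
  obtain r where "rademacher (- k) w q j = of_int r" using rademacher_in_Ints[OF det q] by (auto elim: Ints_cases)
  then have r: "rademacher (- k) w q j - of_int (q * j) = of_int (r - q * j)" by simp
  have "real_of_int (q * (r - q * j)) = of_int (dnum k q - k - (q\<^sup>2 - 1) * j)"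
    using eq unfolding r by simp
  then have "q * (r - q * j) = dnum k q - k - (q\<^sup>2 - 1) * j" by linarith
  then have "admissible q (r - q * j) \<longleftrightarrow> admissible q (dnum k q - k)"
    by (metis admissible_mult_iff admissible_add_iff)
  moreover have "r - q * j \<in> rademacher_values q \<longleftrightarrow> admissible q (r - q * j)"
    using rademacher_values_eq[OF assms(1,2)] by simp
  moreover have "(\<exists>a b. b \<ge> 1 \<and> coprime a b \<and> dsum a b = of_int k / of_int q) \<longleftrightarrow> r - q * j \<in> rademacher_values q"
    using dsum_value_imp_rademacher_value[OF q assms(3) det] rademacher_value_imp_dsum_value[OF q det] unfolding r of_int_eq_iff
    by blast
  ultimately show ?thesis by simp
qed

theorem corollary4p7:
  fixes q :: int
  assumes "2 \<le> q" and "q \<le> 200"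
  shows "Lambda_set q = Gamma_set q \<and>
    (\<forall>k :: int. coprime k q \<longrightarrow>
      ((\<exists>a b :: int. b \<ge> 1 \<and> coprime a b \<and>
          normalized_dedekind_sum a b = of_int k / of_int q) \<longleftrightarrow>
       (\<not> 3 dvd q \<longrightarrow> 3 dvd k) \<and>
       (\<not> 2 dvd q \<longrightarrow>
          (if [q = 3] (mod 4) then [k = 2] (mod 4)
           else if is_square q then [k = 0] (mod 8)
           else [k = 0] (mod 4)))))"
proof -
  have "q > 0" using assms(1) by simp
  then show ?thesis
    using Lambda_set_eq_Gamma_set[OF assms] dsum_values_iff[OF assms] admissible_dnum_iff by blast
qed

end
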